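(* The optimal move counts of the parity-constrained four-peg Tower of Hanoi satisfy \[ \lim_{k\to\infty}\frac{a_{2k}}{a_{2k-1}}=\frac{27}{19},\quad \lim_{k\to\infty}\frac{a_{2k+1}}{a_{2k}}=\frac{38}{27},\quad \lim_{k\to\infty}\frac{b_{2k}}{b_{2k-1}}=\frac{38}{27},\quad \lim_{k\to\infty}\frac{b_{2k+1}}{b_{2k}}=\frac{27}{19}, \] \[ \lim_{k\to\infty}\frac{c_{2k}}{c_{2k-1}}=\frac{34}{31},\quad \lim_{k\to\infty}\frac{c_{2k+1}}{c_{2k}}=\frac{62}{34},\quad \lim_{k\to\infty}\frac{d_{2k}}{d_{2k-1}}=\frac{20}{13},\quad \lim_{k\to\infty}\frac{d_{2k+1}}{d_{2k}}=\frac{26}{20}. \]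
   Context: Parity-constrained four-peg Tower of Hanoi with $n$ discs labelled $1,\dots,n$ (disc $1$ smallest). Four pegs $N_1,E,O,N_2$: $N_1,N_2$ neutral, $E$ only for even-labelled discs, $O$ only for odd-labelled discs. A state places every disc on a parity-compatible peg with discs increasing from top to bottom on each peg. A legal move takes the top disc $d$ of a peg $p$ to a peg $q\ne p$ that is empty or has a larger top disc, with both $p,q$ allowed for the parity of $d$. Starting from all discs on $N_1$: $a_n$ is the minimum number of moves to bring all discs to $N_2$; $b_n$ to reach all even discs on $E$ and all odd on $O$; $c_n$ to reach all odd discs on $O$ and all even on $N_2$; $d_n$ to reach all odd discs on $N_2$ and all even on $E$. *)

theory Defs
  imports "HOL-Analysis.Analysis"
begin

text \<open>
  The discs are the numbers \<open>1, \<dots>, n\<close>, disc 1 being the smallest.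
\<close>

datatype peg = Neutral1 | EvenPeg | OddPeg | Neutral2

definition allowed :: "nat \<Rightarrow> peg set" where
  "allowed d = (if even d then {Neutral1, EvenPeg, Neutral2} else {Neutral1, OddPeg, Neutral2})"

text \<open>
  Since the discs on a peg are increasing from top to bottom, a state is determined by
  the peg of each disc. A state is a function from discs to pegs, with the
  value \<open>undefined\<close> outside \<open>{1..n}\<close>, so that every state is represented by exactly one function.
  The top disc of a nonempty peg is the minimum of the discs on it.
\<close>

definition states :: "nat \<Rightarrow> (nat \<Rightarrow> peg) set" where
  "states n = (\<Pi>\<^sub>E d\<in>{1..n}. allowed d)"

definition discs_on :: "nat \<Rightarrow> (nat \<Rightarrow> peg) \<Rightarrow> peg \<Rightarrow> nat set" where
  "discs_on n s p = {d \<in> {1..n}. s d = p}"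

definition legal_move :: "nat \<Rightarrow> ((nat \<Rightarrow> peg) \<times> (nat \<Rightarrow> peg)) set" where
  "legal_move n = {(s, t). s \<in> states n \<and>
     (\<exists>p q d. discs_on n s p \<noteq> {} \<and> d = Min (discs_on n s p) \<and> q \<noteq> p \<and>
        (discs_on n s q = {} \<or> d < Min (discs_on n s q)) \<and>
        p \<in> allowed d \<and> q \<in> allowed d \<and> t = s(d := q))}"

definition min_moves :: "nat \<Rightarrow> (nat \<Rightarrow> peg) \<Rightarrow> (nat \<Rightarrow> peg) \<Rightarrow> nat" where
  "min_moves n s t = (LEAST m. (s, t) \<in> legal_move n ^^ m)"

text \<open>The state with all even discs on peg \<open>p\<close> and all odd discs on peg \<open>q\<close>.\<close>

definition split_state :: "nat \<Rightarrow> peg \<Rightarrow> peg \<Rightarrow> nat \<Rightarrow> peg" where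
  "split_state n p q = (\<lambda>d\<in>{1..n}. if even d then p else q)"

definition hanoi_a :: "nat \<Rightarrow> nat" where
  "hanoi_a n = min_moves n (split_state n Neutral1 Neutral1) (split_state n Neutral2 Neutral2)"

definition hanoi_b :: "nat \<Rightarrow> nat" where
  "hanoi_b n = min_moves n (split_state n Neutral1 Neutral1) (split_state n EvenPeg OddPeg)"

definition hanoi_c :: "nat \<Rightarrow> nat" where
  "hanoi_c n = min_moves n (split_state n Neutral1 Neutral1) (split_state n Neutral2 OddPeg)"

definition hanoi_d :: "nat \<Rightarrow> nat" where
  "hanoi_d n = min_moves n (split_state n Neutral1 Neutral1) (split_state n EvenPeg Neutral2)"

end

theory Submission
  imports Defs
begin

text \<open>
  Only the parity classes matter: moving disc \<open>d\<close> between the neutral pegs forces all smaller discs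
  onto their own pegs, and moving it between a neutral peg and its own peg forces the smaller discs
  of its parity onto the other neutral peg. Considering the moves of the three largest discs gives
  the recurrence
  \<open>b\<^sub>n = b\<^sub>n\<^sub>-\<^sub>3 + 2 * h (n - 2) + 3 * h (n - 3)\<close> up to a bounded error, with \<open>h d = 2 ^ (d div 2)\<close>, and
  \<open>a\<^sub>n\<close>, \<open>c\<^sub>n\<close>, \<open>d\<^sub>n\<close> are \<open>b\<^sub>m\<close> for some \<open>m < n\<close> (doubled for \<open>a\<^sub>n\<close>) plus explicit powers of two.
  The recurrence has coefficient 1, so bounded errors per step add up to a linear error only, which
  is negligible against the exponential growth. In the lower bound, a path that does not follow
  the optimal pattern is shown to move some piles additional times.
\<close>

section \<open>Sites, piles and moves\<close>

text \<open>Two steps of the recurrence pass six discs and multiply \<open>h\<close> by 8; this is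
  where the sevenths in \<open>beta\<close> come from, which solves the error-free recurrence
  exactly. The lower bound rests on one observation: whenever a disc moves, all smaller discs of its
  parity stand together on the third site. Each parity class therefore behaves like an ordinary
  three-peg tower, and relocations of different classes, or of one class in disjoint time windows,
  may simply be added. The obstacle is that a path may deviate in many ways: any of the largest
  discs can come back, or pass through its own peg instead of crossing directly. Almost every
  deviation already loses by addition of pile costs. The exception is a direct crossing of one disc
  followed by a departure of the next larger one through its own peg: for one parity the sum is
  slightly too small, and the two classes have to be played against each other.\<close>

text \<open>
  Disc \<open>d\<close> of this abstract model is the disc labelled \<open>d + 1\<close>; \<open>Own\<close> stands for the peg reserved
  for the parity of the disc, so it denotes different pegs for different parities.
\<close>

datatype site = N1 | Own | N2

lemma third_site: "\<lbrakk>p \<noteq> q; r \<noteq> p; r \<noteq> q; z \<noteq> p; z \<noteq> q\<rbrakk> \<Longrightarrow> z = (r :: site)"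
  by (cases p; cases q; cases r; cases z) simp_all

text \<open>Shifting the index switches the class: \<open>low (Suc d)\<close> consists of the discs
  below \<open>d\<close> of the other parity, and \<open>low (Suc (Suc d))\<close> is
  \<open>low d\<close> together with \<open>d\<close> itself.\<close>

definition low :: "nat \<Rightarrow> nat set" where
  "low d = {d'. d' < d \<and> even (d + d')}"

lemma finite_low [simp]: "finite (low d)"
  by (simp add: low_def)

lemma low_0 [simp]: "low 0 = {}" and low_1 [simp]: "low (Suc 0) = {}"
  by (auto simp: low_def elim: oddE)

lemma low_Suc_Suc: "low (Suc (Suc d)) = insert d (low d)"
  by (auto simp: low_def less_Suc_eq)

lemma self_notin_low [simp]: "d \<notin> low d"
  by (simp add: low_def)

lemma low_Suc_less: "d' \<in> low (Suc d) \<Longrightarrow> d' < d"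
  by (auto simp: low_def less_Suc_eq)

lemma low_disjoint: "low d \<inter> low (Suc d) = {}"
  by (auto simp: low_def)

lemma low_Un: "low n \<union> low (Suc n) = {..<n}"
  by (auto simp: low_def less_Suc_eq)

text \<open>A smaller disc blocks a move exactly if it lies on the source or target peg. Equal sites
  mean equal pegs, except for \<open>Own\<close> with discs of different parity.\<close>

definition steps :: "nat \<Rightarrow> ((nat \<Rightarrow> site) \<times> (nat \<Rightarrow> site)) set" where
  "steps n = {(s, s(d := q)) | s d q. d < n \<and> q \<noteq> s d \<and>
     (\<forall>d'<d. s d' \<in> {s d, q} \<longrightarrow> s d' = Own \<and> odd (d + d'))}"

text \<open>The pile \<open>low d\<close> has \<open>d div 2\<close> discs, so
  \<open>h d - 1\<close> is the classical three-peg cost of relocating it.\<close>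

abbreviation h :: "nat \<Rightarrow> real" where
  "h d \<equiv> 2 ^ (d div 2)"

text \<open>
  Asymptotic values: \<open>beta m\<close> for moving \<open>m\<close> discs from \<open>N1\<close> to their own pegs, and \<open>kappa m\<close> for
  moving discs \<open>0, \<dots>, m\<close> from \<open>N1\<close> so that the parity class of \<open>m\<close> ends on its own peg and the
  other class on \<open>N2\<close>. In contrast, \<open>nu\<close> and \<open>omega\<close> are only lower bounds, chosen as the solutions
  of the recursions in the proofs of \<open>nu_bound\<close> and \<open>omega_bound\<close>.
\<close>

definition beta :: "nat \<Rightarrow> real" where
  "beta m = (if even m then 19/7 else 27/7) * h m"

definition omega :: "nat \<Rightarrow> real" where
  "omega m = (if even m then 47/14 else 33/7) * h m"

definition nu :: "nat \<Rightarrow> real" where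
  "nu m = (if even m then 33/14 else 47/14) * h m"

text \<open>The increment 20 per disc exceeds the additive constants lost in one induction step, and
  it makes the claims for fewer than three discs trivial.\<close>

definition err :: "nat \<Rightarrow> real" where
  "err m = 20 * (real m + 1)"

lemmas bound_defs = beta_def omega_def nu_def err_def

definition kappa :: "nat \<Rightarrow> real" where
  "kappa m = (if even m then 31/7 else 40/7) * h m"

lemma kappa_Suc: "kappa (Suc e) = beta e + 2 * h (Suc e) + h e"
  by (cases "even e") (simp_all add: kappa_def beta_def)

lemma h_parity_cases:
  obtains c where "even m" "h m = c" "h (Suc m) = c" "1 \<le> c"
    | c where "odd m" "h m = c" "h (Suc m) = 2 * c" "1 \<le> c"
  by (cases "even m") auto

lemma h_Suc: "h d \<le> h (Suc d)" "h (Suc d) \<le> 2 * h d"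
  by (cases d rule: h_parity_cases; simp)+

section \<open>Lower bounds\<close>

locale hanoi_path =
  fixes n T :: nat and s :: "nat \<Rightarrow> nat \<Rightarrow> site"
  assumes step: "\<And>t. t < T \<Longrightarrow> (s t, s (Suc t)) \<in> steps n"
begin

section \<open>Move counts and distinguished moves of a path\<close>

definition cnt :: "nat set \<Rightarrow> nat \<Rightarrow> nat \<Rightarrow> real" where
  "cnt D t t' = (\<Sum>d\<in>D. real (card {u \<in> {t..<t'}. s (Suc u) d \<noteq> s u d}))"

definition pile_at :: "nat \<Rightarrow> site \<Rightarrow> nat \<Rightarrow> bool" where
  "pile_at d p t \<longleftrightarrow> (\<forall>d'\<in>low d. s t d' = p)"

lemma pile_at_Suc_Suc: "pile_at (Suc (Suc d)) p t \<longleftrightarrow> s t d = p \<and> pile_at d p t"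
  by (simp add: pile_at_def low_Suc_Suc)

lemma move_blocks:
  assumes "u < T" "s (Suc u) d \<noteq> s u d" "d' < d" "s u d' \<in> {s u d, s (Suc u) d}"
  shows "s u d' = Own \<and> odd (d + d')"
proof -
  obtain e q where "s (Suc u) = (s u)(e := q)"
    "\<forall>d'<e. s u d' \<in> {s u e, q} \<longrightarrow> s u d' = Own \<and> odd (e + d')"
    using step[OF assms(1)] by (auto simp: steps_def)
  moreover from this have "e = d" using assms(2) by (auto split: if_splits)
  ultimately show ?thesis using assms(3,4) by auto
qed

lemma move_unique:
  assumes "u < T" "s (Suc u) d \<noteq> s u d" "d' \<noteq> d"
  shows "s (Suc u) d' = s u d'"
proof -
  obtain e q where "s (Suc u) = (s u)(e := q)"
    using step[OF assms(1)] by (auto simp: steps_def)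
  then show ?thesis using assms by (auto split: if_splits)
qed

text \<open>A smaller disc of the same parity may be on neither end of the move, and only one site
  is left. Every move of a disc thus locates its whole pile.\<close>

lemma pile_at_move:
  assumes "u < T" "s (Suc u) d \<noteq> s u d" "r \<noteq> s u d" "r \<noteq> s (Suc u) d"
  shows "pile_at d r u"
  unfolding pile_at_def
proof
  fix d' assume "d' \<in> low d"
  then have "s u d' \<notin> {s u d, s (Suc u) d}"
    using move_blocks[OF assms(1,2), of d'] by (auto simp: low_def)
  then show "s u d' = r"
    using third_site[OF assms(2,4,3)] by simp
qed

lemma neutral_clear:
  assumes "u < T" "s (Suc u) d \<noteq> s u d" "d' < d" "c \<in> {s u d, s (Suc u) d}" "c \<noteq> Own"
  shows "s u d' \<noteq> c"
  using move_blocks[OF assms(1-3)] assms(4,5) by auto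

lemma direct_move:
  assumes "u < T" "{s u d, s (Suc u) d} = {N1, N2}" "d' < d"
  shows "s u d' = Own"
proof -
  have "s (Suc u) d \<noteq> s u d" using assms(2) by (metis doubleton_eq_iff site.distinct(3))
  then have "s u d' \<noteq> N1" "s u d' \<noteq> N2"
    using neutral_clear[OF assms(1) _ assms(3)] unfolding assms(2) by simp_all
  then show ?thesis by (cases "s u d'") simp_all
qed

lemma first_leave:
  assumes "t \<le> t'" "t' \<le> T" "s t d = p" "s t' d \<noteq> p"
  shows "\<exists>u r. t \<le> u \<and> u < t' \<and> s u d = p \<and> s (Suc u) d \<noteq> p \<and> (\<forall>v\<in>{t..u}. s v d = p) \<and>
    r \<noteq> p \<and> r \<noteq> s (Suc u) d \<and> pile_at d r u"
proof -
  define w where "w = (LEAST v. t \<le> v \<and> s v d \<noteq> p)"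
  have w: "t \<le> w \<and> s w d \<noteq> p" unfolding w_def
    by (rule LeastI[of _ t']) (use assms in auto)
  have wl: "w \<le> t'" unfolding w_def by (rule Least_le) (use assms in auto)
  have min: "s v d = p" if "t \<le> v" "v < w" for v
    using not_less_Least[of v "\<lambda>v. t \<le> v \<and> s v d \<noteq> p"] that unfolding w_def by auto
  have "w \<noteq> t" using w assms by auto
  then obtain u where u: "w = Suc u" "t \<le> u" using w by (cases w) auto
  obtain r where r: "r \<noteq> p" "r \<noteq> s (Suc u) d"
    by (metis site.distinct)
  have "pile_at d r u"
    by (rule pile_at_move) (use r u w wl min assms in auto)
  then show ?thesis
    using r u w wl min by (intro exI[of _ u] exI[of _ r]) auto
qed

lemma last_arrive:
  assumes "t \<le> t'" "t' \<le> T" "s t d \<noteq> q" "s t' d = q"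
  shows "\<exists>u r. t \<le> u \<and> u < t' \<and> s u d \<noteq> q \<and> s (Suc u) d = q \<and> (\<forall>v\<in>{u<..t'}. s v d = q) \<and>
    r \<noteq> q \<and> r \<noteq> s u d \<and> pile_at d r u"
proof -
  define w where "w = (GREATEST v. v \<le> t' \<and> s v d \<noteq> q)"
  have w: "w \<le> t' \<and> s w d \<noteq> q" unfolding w_def
    by (rule GreatestI_nat[of _ t t']) (use assms in auto)
  have max: "v \<le> w" if "v \<le> t'" "s v d \<noteq> q" for v
    unfolding w_def by (rule Greatest_le_nat[of _ _ t']) (use that in auto)
  have "w < t'" using w assms by (cases "w = t'") auto
  moreover have tw: "t \<le> w" using max assms by auto
  moreover have after: "s v d = q" if "w < v" "v \<le> t'" for v using max that by force
  moreover obtain r where r: "r \<noteq> q" "r \<noteq> s w d"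
    by (metis site.distinct)
  moreover have "pile_at d r w"
    by (rule pile_at_move) (use r w after[of "Suc w"] \<open>w < t'\<close> assms in auto)
  ultimately show ?thesis
    using w by (intro exI[of _ w] exI[of _ r]) auto
qed

lemma cnt_nonneg: "0 \<le> cnt D t t'"
  unfolding cnt_def by (simp add: sum_nonneg)

lemma cnt_split:
  assumes "t \<le> u" "u \<le> t'"
  shows "cnt D t t' = cnt D t u + cnt D u t'"
proof -
  have "card {v \<in> {t..<t'}. s (Suc v) d \<noteq> s v d} =
      card {v \<in> {t..<u}. s (Suc v) d \<noteq> s v d} + card {v \<in> {u..<t'}. s (Suc v) d \<noteq> s v d}" for d
    by (subst card_Un_disjoint[symmetric]) (use assms in \<open>auto intro: arg_cong[where f = card]\<close>)
  then show ?thesis unfolding cnt_def by (simp add: sum.distrib)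
qed

lemma cnt_lessThan: "cnt {..<d} t t' = cnt (low d) t t' + cnt (low (Suc d)) t t'"
  unfolding cnt_def low_Un[symmetric] by (rule sum.union_disjoint) (auto simp: low_disjoint)

lemma cnt_low_Suc_Suc: "cnt (low (Suc (Suc d))) t t' = cnt {d} t t' + cnt (low d) t t'"
  unfolding cnt_def low_Suc_Suc by simp

lemma cnt_ge_1:
  assumes "t \<le> t'" "t' \<le> T" "s t d \<noteq> s t' d"
  shows "1 \<le> cnt {d} t t'"
proof -
  obtain u where "t \<le> u" "u < t'" "s u d = s t d" "s (Suc u) d \<noteq> s t d"
    using first_leave[OF assms(1,2) refl] assms(3) by metis
  then have "card {u} \<le> card {u \<in> {t..<t'}. s (Suc u) d \<noteq> s u d}"
    by (intro card_mono) auto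
  then show ?thesis by (simp add: cnt_def)
qed

lemma first_arrive:
  assumes "t \<le> t'" "t' \<le> T" "s t d \<noteq> q" "s t' d = q"
  shows "\<exists>u r. t \<le> u \<and> u < t' \<and> s u d \<noteq> q \<and> s (Suc u) d = q \<and> (\<forall>v\<in>{t..u}. s v d \<noteq> q) \<and>
    r \<noteq> q \<and> r \<noteq> s u d \<and> pile_at d r u"
proof -
  define w where "w = (LEAST v. t \<le> v \<and> s v d = q)"
  have w: "t \<le> w \<and> s w d = q" unfolding w_def
    by (rule LeastI[of _ t']) (use assms in auto)
  have wl: "w \<le> t'" unfolding w_def by (rule Least_le) (use assms in auto)
  have min: "s v d \<noteq> q" if "t \<le> v" "v < w" for v
    using not_less_Least[of v "\<lambda>v. t \<le> v \<and> s v d = q"] that unfolding w_def by auto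
  have "w \<noteq> t" using w assms by auto
  then obtain u where u: "w = Suc u" "t \<le> u" using w by (cases w) auto
  obtain r where r: "r \<noteq> q" "r \<noteq> s u d"
    by (metis site.distinct)
  have "pile_at d r u"
    by (rule pile_at_move) (use r u w wl min[of u] assms in auto)
  then show ?thesis
    using r u w wl min by (intro exI[of _ u] exI[of _ r]) auto
qed

lemma last_leave:
  assumes "t \<le> t'" "t' \<le> T" "s t d = p" "s t' d \<noteq> p"
  shows "\<exists>u. t \<le> u \<and> u < t' \<and> s u d = p \<and> (\<forall>v\<in>{u<..t'}. s v d \<noteq> p)"
proof -
  define w where "w = (GREATEST v. v \<le> t' \<and> s v d = p)"
  have w: "w \<le> t' \<and> s w d = p" unfolding w_def
    by (rule GreatestI_nat[of _ t t']) (use assms in auto)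
  have max: "v \<le> w" if "v \<le> t'" "s v d = p" for v
    unfolding w_def by (rule Greatest_le_nat[of _ _ t']) (use that in auto)
  have "w < t'" using w assms by (cases "w = t'") auto
  then show ?thesis
    using w max assms by (intro exI[of _ w]) force
qed

lemma stuck_below:
  assumes "t \<le> u" "u \<le> T" "s t d = c" "c \<noteq> Own" "d' < d" "\<And>v. \<lbrakk>t \<le> v; v \<le> u\<rbrakk> \<Longrightarrow> s v d' = c"
  shows "s u d = c"
proof (rule ccontr)
  assume "s u d \<noteq> c"
  then obtain w where w: "t \<le> w" "w < u" "s w d = c" "s (Suc w) d \<noteq> c"
    using first_leave[OF assms(1,2,3)] by blast
  then have "s w d' \<noteq> c"
    by (intro neutral_clear[of w d]) (use assms in auto)
  then show False using assms(6) w by auto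
qed

section \<open>Cost of relocating one parity class\<close>

lemma pile_at_lessThan:
  assumes "\<And>d. d < m \<Longrightarrow> s t d = p" "j \<le> Suc m"
  shows "pile_at j p t"
  unfolding pile_at_def
proof
  fix d assume "d \<in> low j"
  then have "d < m" using assms(2) by (auto simp: low_def nat_less_le le_Suc_eq)
  then show "s t d = p" using assms(1) by simp
qed

text \<open>The classical three-peg argument: the smaller pile is relocated once before the largest
  disc first leaves \<open>p\<close> and once after it last arrives at \<open>q\<close>, and these
  windows are disjoint.\<close>

lemma pile_cost:
  assumes "t \<le> t'" "t' \<le> T" "pile_at d p t" "pile_at d q t'" "p \<noteq> q"
  shows "h d - 1 \<le> cnt (low d) t t'"
  using assms
proof (induction d arbitrary: p q t t' rule: induct_nat_012)
  case (ge2 d)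
  have st: "s t d = p" "s t' d = q" "pile_at d p t" "pile_at d q t'"
    using ge2.prems by (auto simp: pile_at_Suc_Suc)
  have neq: "s t' d \<noteq> p" "s t d \<noteq> q" using st ge2.prems(5) by auto
  obtain u r where u: "t \<le> u" "u < t'" "s u d = p" "r \<noteq> p" "pile_at d r u"
    using first_leave[OF ge2.prems(1,2) st(1) neq(1)] by blast
  have "u \<le> t'" "s u d \<noteq> q" using u ge2.prems(5) by auto
  then obtain w r' where w: "u \<le> w" "w < t'" "r' \<noteq> q" "pile_at d r' w"
    using last_arrive[OF _ ge2.prems(2) _ st(2)] by blast
  have "h d - 1 \<le> cnt (low d) t u"
    by (rule ge2.IH(1)[OF _ _ st(3) u(5)]) (use u ge2.prems in auto)
  moreover have "h d - 1 \<le> cnt (low d) w t'"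
    by (rule ge2.IH(1)[OF _ _ w(4) st(4)]) (use w ge2.prems in auto)
  moreover have "cnt (low d) t u + cnt (low d) w t' \<le> cnt (low d) t t'"
    using cnt_split[of t u t' "low d"] cnt_split[of u w t' "low d"] u w cnt_nonneg[of "low d" u w] by simp
  moreover have "1 \<le> cnt {d} t t'"
    by (rule cnt_ge_1) (use ge2.prems st in auto)
  ultimately show ?case by (simp add: cnt_low_Suc_Suc)
qed (simp_all add: cnt_nonneg)

text \<open>\<open>low d\<close> already lies on the target and must make room for \<open>d\<close>:
  it goes away and comes back, although its position at both ends is the same.\<close>

lemma pile_cost_gather:
  assumes "t \<le> t'" "t' \<le> T" "s t d \<noteq> q" "pile_at d q t" "pile_at (Suc (Suc d)) q t'"
  shows "2 * h d - 1 \<le> cnt (low (Suc (Suc d))) t t'"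
proof -
  have st: "s t' d = q" "pile_at d q t'" using assms(5) by (auto simp: pile_at_Suc_Suc)
  obtain w r where w: "t \<le> w" "w < t'" "r \<noteq> q" "pile_at d r w"
    using last_arrive[OF assms(1,2,3) st(1)] by blast
  have "h d - 1 \<le> cnt (low d) t w"
    by (rule pile_cost[OF _ _ assms(4) w(4)]) (use w assms in auto)
  moreover have "h d - 1 \<le> cnt (low d) w t'"
    by (rule pile_cost[OF _ _ w(4) st(2)]) (use w assms in auto)
  moreover have "cnt (low d) t w + cnt (low d) w t' = cnt (low d) t t'"
    using cnt_split[of t w t' "low d"] w by simp
  moreover have "1 \<le> cnt {d} t t'"
    by (rule cnt_ge_1) (use assms st in auto)
  ultimately show ?thesis by (simp add: cnt_low_Suc_Suc)
qed

text \<open>A stop of \<open>d\<close> at \<open>y\<close> turns two relocations of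
  \<open>low d\<close> into three. Entering \<open>y\<close> from \<open>p\<close> needs the pile on
  \<open>q\<close>, leaving \<open>y\<close> for \<open>q\<close> needs it on \<open>p\<close>;
  entering or leaving in the other way costs a second relocation within that half.\<close>

lemma pile_cost_detour:
  assumes "t \<le> u" "u \<le> t'" "t' \<le> T" and p: "pile_at (Suc (Suc d)) p t"
    and y: "s u d = y" and q: "pile_at (Suc (Suc d)) q t'"
    and "p \<noteq> q" "p \<noteq> y" "q \<noteq> y"
  shows "3 * (h d - 1) \<le> cnt (low (Suc (Suc d))) t t'"
proof -
  have st: "s t d = p" "s t' d = q" "pile_at d p t" "pile_at d q t'"
    using p q by (auto simp: pile_at_Suc_Suc)
  note pc = pile_cost[where d = d]
  have sites: "z = p \<or> z = q \<or> z = y" for z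
    using third_site[of p q y z] assms(7-9) by blast
  have uT: "u \<le> T" and ny: "s t d \<noteq> y" "s t' d \<noteq> y" using st assms by auto
  obtain a r where a: "t \<le> a" "a < u" "s a d \<noteq> y" "s (Suc a) d = y" "r \<noteq> y" "r \<noteq> s a d" "pile_at d r a"
    using last_arrive[OF assms(1) uT ny(1) y] by blast
  obtain b r' where b: "u \<le> b" "b < t'" "s b d = y" "s (Suc b) d \<noteq> y" "r' \<noteq> y" "r' \<noteq> s (Suc b) d" "pile_at d r' b"
    using first_leave[OF assms(2,3) y ny(2)] by blast
  have A: "pile_at d q a \<and> h d - 1 \<le> cnt (low d) t a \<or> pile_at d p a \<and> 2 * (h d - 1) \<le> cnt (low d) t a"
  proof (cases "s a d = p")
    case True
    then have "pile_at d q a" using a sites by metis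
    then show ?thesis using pc[OF _ _ st(3), of a q] a b assms by auto
  next
    case False
    then have pa: "pile_at d p a" using a sites by metis
    have aT: "a \<le> T" using a uT by auto
    obtain v r where v: "t \<le> v" "v < a" "r \<noteq> p" "pile_at d r v"
      using first_leave[OF a(1) aT st(1) False] by blast
    have "h d - 1 \<le> cnt (low d) t v" "h d - 1 \<le> cnt (low d) v a"
      using pc[OF _ _ st(3) v(4)] pc[OF _ _ v(4) pa] v aT by auto
    then show ?thesis using cnt_split[of t v a "low d"] v pa by auto
  qed
  have B: "pile_at d p b \<and> h d - 1 \<le> cnt (low d) b t' \<or> pile_at d q b \<and> 2 * (h d - 1) \<le> cnt (low d) b t'"
  proof (cases "s (Suc b) d = q")
    case True
    then have "pile_at d p b" using b sites by metis
    then show ?thesis using pc[OF _ _ _ st(4), of b p] a b assms by auto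
  next
    case False
    then have qb: "pile_at d q b" using b sites by metis
    have bq: "b \<le> t'" "s b d \<noteq> q" using b assms by auto
    obtain v r where v: "b \<le> v" "v < t'" "r \<noteq> q" "pile_at d r v"
      using last_arrive[OF bq(1) assms(3) bq(2) st(2)] by blast
    have "h d - 1 \<le> cnt (low d) b v" "h d - 1 \<le> cnt (low d) v t'"
      using pc[OF _ _ qb v(4)] pc[OF _ _ v(4) st(4)] v b assms by auto
    then show ?thesis using cnt_split[of b v t' "low d"] v qb by auto
  qed
  have sp: "cnt (low d) t t' = cnt (low d) t a + cnt (low d) a b + cnt (low d) b t'"
    using cnt_split[of t a t' "low d"] cnt_split[of a b t' "low d"] a b by simp
  have "h d - 1 \<le> cnt (low d) a b" if "pile_at d q a" "pile_at d p b"
    using pc[OF _ _ that] a b assms by auto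
  moreover have "(1::real) \<le> h d" by simp
  ultimately have "3 * (h d - 1) \<le> cnt (low d) t t'"
    using A B sp cnt_nonneg[of "low d" a b] by argo
  then show ?thesis using cnt_nonneg[of "{d}" t t'] unfolding cnt_low_Suc_Suc by linarith
qed


section \<open>Lower bound for bringing all discs to their own pegs\<close>

definition beta_bound :: "nat \<Rightarrow> bool" where
  "beta_bound m \<longleftrightarrow> (\<forall>t t'. t \<le> t' \<longrightarrow> t' \<le> T \<longrightarrow> (\<forall>d<m. s t d = N1) \<longrightarrow> (\<forall>d<m. s t' d = Own) \<longrightarrow>
     beta m - err m \<le> cnt {..<m} t t')"

lemma beta_boundD:
  assumes "beta_bound m" "t \<le> t'" "t' \<le> T" "\<And>d. d < m \<Longrightarrow> s t d = N1" "\<And>d. d < m \<Longrightarrow> s t' d = Own"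
  shows "beta m - err m \<le> cnt {..<m} t t'"
  using assms unfolding beta_bound_def by blast

lemma leave_N1:
  assumes "u < T" "s u d = N1" "s (Suc u) d \<noteq> N1"
  obtains (direct) "s (Suc u) d = N2" "\<And>d'. d' < d \<Longrightarrow> s u d' = Own"
    | (own) "s (Suc u) d = Own" "pile_at d N2 u" "\<And>d'. d' < d \<Longrightarrow> s u d' \<noteq> N1"
proof (cases "s (Suc u) d")
  case N1 then show ?thesis using assms by simp
next
  case N2 then show ?thesis using direct_move[OF assms(1), of d] assms(2) by (intro direct) auto
next
  case Own
  moreover have "pile_at d N2 u" by (rule pile_at_move) (use assms Own in auto)
  moreover have "s u d' \<noteq> N1" if "d' < d" for d'
    by (rule neutral_clear[OF assms(1) _ that]) (use assms Own in auto)
  ultimately show ?thesis by (rule own)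
qed

text \<open>
  The second summand counts only one parity class after \<open>t1\<close>; this is what remains when the two
  classes are gathered on \<open>N2\<close> one after the other, and it makes the induction go through.
\<close>

lemma omega_bound:
  assumes "\<And>k. k < m \<Longrightarrow> beta_bound k"
    and "t0 \<le> t1" "t1 \<le> t2" "t2 \<le> T" "\<And>d. d < m \<Longrightarrow> s t0 d = N1"
    and "pile_at m N2 t1" "\<forall>d\<in>low (Suc m). s t1 d \<noteq> N1" "pile_at (Suc m) N2 t2"
  shows "omega m - err m \<le> cnt {..<m} t0 t1 + cnt (low (Suc m)) t1 t2"
  using assms
proof (induction m arbitrary: t1 t2)
  case 0
  then show ?case by (simp add: bound_defs cnt_def)
next
  case (Suc m)
  note le = Suc.prems(2-4)
  have t1T: "t1 \<le> T" using le by simp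
  have m: "s t0 m = N1" "s t1 m \<noteq> N1"
    using Suc.prems(5,7) by (auto simp: low_Suc_Suc)
  obtain u where u: "t0 \<le> u" "u < t1" "s u m = N1" "s (Suc u) m \<noteq> N1"
    using first_leave[OF le(1) t1T m] by blast
  have uT: "u < T" using u t1T by simp
  have N2: "s t2 m = N2" "pile_at m N2 t2"
    using Suc.prems(8) by (auto simp: pile_at_Suc_Suc)
  note sets = cnt_lessThan cnt_low_Suc_Suc
  show ?case using uT u(3,4)
  proof (cases rule: leave_N1)
    case direct
    have "beta m - err m \<le> cnt {..<m} t0 u"
      by (rule beta_boundD) (use Suc.prems direct u uT in auto)
    moreover have "h (Suc m) - 1 \<le> cnt (low (Suc m)) u t1"
      by (rule pile_cost[of _ _ _ Own N2]) (use Suc.prems direct u t1T pile_at_lessThan[of m u Own] in auto)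
    moreover have "h m - 1 \<le> cnt (low m) u t2"
      by (rule pile_cost[of _ _ _ Own N2]) (use Suc.prems direct u N2 pile_at_lessThan[of m u Own] in auto)
    moreover have "cnt {..<Suc m} t0 t1 = cnt {..<Suc m} t0 u + cnt {..<Suc m} u t1"
      "cnt (low m) u t2 = cnt (low m) u t1 + cnt (low m) t1 t2"
      by (rule cnt_split; use u le in simp)+
    \<comment> \<open>In leading terms this is an equality for even \<open>m\<close>, and the
      corresponding estimate of the other case is one for odd \<open>m\<close>; the two together
      determine \<open>omega\<close>.\<close>
    moreover have "omega (Suc m) - err (Suc m) \<le> beta m - err m + (h (Suc m) - 1) + (h m - 1)"
      by (cases m rule: h_parity_cases) (simp_all add: bound_defs)
    ultimately show ?thesis
      using cnt_nonneg[of "{m}" t0 u] cnt_nonneg[of "{m}" u t1] cnt_nonneg[of "{m}" t1 t2]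
      unfolding sets by linarith
  next
    case own
    have "omega m - err m \<le> cnt {..<m} t0 u + cnt (low (Suc m)) u t1"
      by (rule Suc.IH) (use Suc.prems own u t1T in \<open>auto dest: low_Suc_less\<close>)
    moreover have "2 * h m - 1 \<le> cnt (low (Suc (Suc m))) u t2"
      by (rule pile_cost_gather) (use Suc.prems own u in auto)
    moreover have "cnt {..<Suc m} t0 t1 = cnt {..<Suc m} t0 u + cnt {..<Suc m} u t1"
      "cnt (low (Suc (Suc m))) u t2 = cnt (low (Suc (Suc m))) u t1 + cnt (low (Suc (Suc m))) t1 t2"
      by (rule cnt_split; use u le in simp)+
    moreover have "omega (Suc m) - err (Suc m) \<le> omega m - err m + (2 * h m - 1)"
      by (cases m rule: h_parity_cases) (simp_all add: bound_defs)
    ultimately show ?thesis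
      using cnt_nonneg[of "{m}" t0 u]
      unfolding sets by linarith
  qed
qed

text \<open>This is the price of the position needed before disc \<open>m\<close> can leave
  \<open>N1\<close> through its own peg. If the next smaller disc also left through its own peg,
  \<open>omega_bound\<close> applies with \<open>t1\<close> as its last time; this branch is the
  cheaper one, whence \<open>nu (Suc m) = omega m\<close>.\<close>

lemma nu_bound:
  assumes "\<And>k. k < m \<Longrightarrow> beta_bound k"
    and "t0 \<le> t1" "t1 \<le> T" "\<And>d. d < m \<Longrightarrow> s t0 d = N1"
    and "pile_at m N2 t1" "\<forall>d\<in>low (Suc m). s t1 d \<noteq> N1"
  shows "nu m - err m \<le> cnt {..<m} t0 t1"
proof (cases m)
  case 0
  then show ?thesis by (simp add: bound_defs cnt_def)
next
  case (Suc m')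
  note prems = assms[unfolded Suc]
  have m: "s t0 m' = N1" "s t1 m' \<noteq> N1"
    using prems(4,6) by (auto simp: low_Suc_Suc)
  obtain u where u: "t0 \<le> u" "u < t1" "s u m' = N1" "s (Suc u) m' \<noteq> N1"
    using first_leave[OF assms(2,3) m] by blast
  have uT: "u < T" using u assms(3) by simp
  have split: "cnt {..<m} t0 t1 = cnt {..<m} t0 u + cnt {..<m} u t1"
    by (rule cnt_split; use u in simp)
  note sets = cnt_lessThan cnt_low_Suc_Suc
  show ?thesis using uT u(3,4)
  proof (cases rule: leave_N1)
    case direct
    have "beta m' - err m' \<le> cnt {..<m'} t0 u"
      by (rule beta_boundD) (use prems direct u uT in auto)
    moreover have "h (Suc m') - 1 \<le> cnt (low (Suc m')) u t1"
      by (rule pile_cost[of _ _ _ Own N2]) (use prems direct u pile_at_lessThan[of m' u Own] in auto)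
    moreover have "nu (Suc m') - err (Suc m') \<le> beta m' - err m' + (h (Suc m') - 1)"
      by (cases m' rule: h_parity_cases) (simp_all add: bound_defs)
    ultimately show ?thesis
      using cnt_nonneg[of "{m'}" t0 u] cnt_nonneg[of "{m'}" u t1] cnt_nonneg[of "low m'" u t1] split
      unfolding Suc sets by linarith
  next
    case own
    have "omega m' - err m' \<le> cnt {..<m'} t0 u + cnt (low (Suc m')) u t1"
      by (rule omega_bound) (use prems own u in \<open>auto dest: low_Suc_less\<close>)
    moreover have "nu (Suc m') - err (Suc m') \<le> omega m' - err m'"
      by (cases m' rule: h_parity_cases) (simp_all add: bound_defs)
    ultimately show ?thesis
      using cnt_nonneg[of "{m'}" t0 u] cnt_nonneg[of "{m'}" u t1] cnt_nonneg[of "low m'" u t1] split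
      unfolding Suc sets by linarith
  qed
qed

text \<open>
  Here \<open>f\<close> moves directly to \<open>N2\<close> at time \<open>\<tau>\<close> while \<open>e\<close> leaves \<open>N1\<close> via its own peg. Counting each
  parity class separately gives the bound without \<open>h g / 2\<close>, which is too small when \<open>e\<close> is odd.
  The extra term comes from the interaction of the classes: in every case some pile has
  to make an additional detour.
\<close>

lemma direct_extra:
  fixes a :: nat
  defines "g \<equiv> Suc a" and "f \<equiv> Suc (Suc a)" and "e \<equiv> Suc (Suc (Suc a))"
  assumes times: "\<tau> < t1" "t1 < t2" "t2 \<le> t3" "t3 \<le> t4" "t4 \<le> T"
    and tau: "s (Suc \<tau>) f = N2" "\<And>d. d < f \<Longrightarrow> s \<tau> d = Own" "pile_at f Own (Suc \<tau>)"
    and t1: "s (Suc t1) e = Own" "pile_at e N2 t1" "\<And>d. d < e \<Longrightarrow> s t1 d \<noteq> N1"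
    and e12: "\<And>v. \<lbrakk>t1 < v; v \<le> t2\<rbrakk> \<Longrightarrow> s v e \<noteq> N1"
    and t2: "pile_at (Suc e) N2 t2" "\<And>d. d \<le> e \<Longrightarrow> s t2 d \<noteq> N1"
    and t3: "pile_at (Suc (Suc e)) N2 t3"
    and t4: "pile_at (Suc e) Own t4"
  shows "2 * h e + h f + h (Suc e) + h g / 2 - 10 \<le> cnt (low e) t1 t3 + cnt (low (Suc e)) \<tau> t4"
proof -
  note defs = g_def f_def e_def
  have le: "low e = insert g (low g)" and lSe: "low (Suc e) = insert f (low f)" and lf: "low f = insert a (low a)"
    by (simp_all add: defs low_Suc_Suc)
  have pe: "pile_at e p t \<longleftrightarrow> s t g = p \<and> pile_at g p t"
    and pSe: "pile_at (Suc e) p t \<longleftrightarrow> s t f = p \<and> pile_at f p t"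
    and pf: "pile_at f p t \<longleftrightarrow> s t a = p \<and> pile_at a p t" for p t
    by (auto simp: pile_at_def le lSe lf)
  have ce: "cnt (low e) t t' = cnt {g} t t' + cnt (low g) t t'"
    and cSe: "cnt (low (Suc e)) t t' = cnt {f} t t' + cnt (low f) t t'" for t t'
    by (simp_all add: defs cnt_low_Suc_Suc)
  have sub: "cnt (low g) t t' \<le> cnt (low e) t t'" "cnt (low f) t t' \<le> cnt (low (Suc e)) t t'" for t t'
    using cnt_nonneg[of "{g}" t t'] cnt_nonneg[of "{f}" t t'] unfolding ce cSe by linarith+
  obtain A G where hs: "h e = 2 * G" "h f = 2 * A" "h (Suc e) = 4 * A" "h g = G" "h a = A"
    "A \<le> G" "G \<le> 2 * A" "1 \<le> A" "1 \<le> G"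
    by (rule that[of "h g" "h a"]) (use h_Suc[of a] in \<open>simp_all add: defs\<close>)
  have e23: "s t3 e = N2" "pile_at e N2 t3" using t3 by (auto simp: pile_at_Suc_Suc)
  note split = cnt_split
  have P: "h e - 1 \<le> cnt (low e) t t'" if "pile_at e p t" "pile_at e q t'" "p \<noteq> q" "t \<le> t'" "t' \<le> t3" for p q t t'
    by (rule pile_cost) (use that times in auto)
  have G: "h g - 1 \<le> cnt (low g) t t'" if "pile_at g p t" "pile_at g q t'" "p \<noteq> q" "t \<le> t'" "t' \<le> t3" for p q t t'
    by (rule pile_cost) (use that times in auto)
  have F: "h f - 1 \<le> cnt (low f) t t'" if "pile_at f p t" "pile_at f q t'" "p \<noteq> q" "t \<le> t'" "t' \<le> t4" for p q t t'
    by (rule pile_cost) (use that times in auto)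
  have F1: "h f - 1 \<le> cnt (low f) \<tau> t2"
    by (rule F[OF _ t2(1)[unfolded pSe, THEN conjunct2]])
      (use tau times pile_at_lessThan[of f \<tau> Own f] in auto)
  have F2: "h (Suc e) - 1 \<le> cnt (low (Suc e)) t2 t4"
    by (rule pile_cost[OF _ _ t2(1) t4]) (use times in auto)
  have baseR: "h f + h (Suc e) - 2 \<le> cnt (low (Suc e)) \<tau> t4"
    using F1 F2 sub(2)[of \<tau> t2] split[of \<tau> t2 t4 "low (Suc e)"] times by simp
  obtain v0 r0 where v0: "Suc t1 \<le> v0" "v0 < t3" "r0 \<noteq> N2" "pile_at e r0 v0"
    using last_arrive[of "Suc t1" t3 e N2] times t1(1) e23 by auto
  have baseP: "2 * h e - 2 \<le> cnt (low e) t1 t3"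
    using P[OF t1(2) v0(4)] P[OF v0(4) e23(2)] v0 split[of t1 v0 t3 "low e"] by simp
  \<comment> \<open>The surplus \<open>h g / 2\<close> may be found wholly in the class of
    \<open>g\<close> (\<open>viaP\<close>) or wholly in the class of \<open>f\<close>
    (\<open>viaR\<close>); the base estimate serves the other class.\<close>
  have viaP: ?thesis if "2 * h e + h g / 2 - 8 \<le> cnt (low e) t1 t3"
    using that baseR by linarith
  have viaR: ?thesis if "h f + h (Suc e) + h g / 2 - 8 \<le> cnt (low (Suc e)) \<tau> t4"
    using that baseP by linarith
  show ?thesis
  proof (cases "\<exists>v\<in>{t1<..t2}. s v e = N2")
    case True
    then obtain v where v: "t1 < v" "v \<le> t2" "s v e = N2" by auto
    obtain t5 r where t5: "Suc t1 \<le> t5" "t5 < v" "s t5 e = Own" "s (Suc t5) e \<noteq> Own"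
      "r \<noteq> Own" "r \<noteq> s (Suc t5) e" "pile_at e r t5"
      using first_leave[of "Suc t1" v e Own] v t1(1) times by auto
    have N2: "s (Suc t5) e = N2" using e12[of "Suc t5"] t5 v by (cases "s (Suc t5) e") auto
    then have r: "r = N1" using t5 by (cases r) auto
    have below: "s t5 d \<noteq> N2" if "d < e" for d
      by (rule neutral_clear[OF _ _ that]) (use t5 v times N2 in auto)
    \<comment> \<open>\<open>f\<close> must be off \<open>N2\<close> at \<open>t5\<close> but on it
      at \<open>t2\<close>. A visit to \<open>Own\<close> makes \<open>low f\<close> move twice
      before \<open>t2\<close>; otherwise \<open>f\<close> goes back directly to \<open>N1\<close>,
      which drives all smaller discs to \<open>Own\<close>.\<close>
    show ?thesis
    proof (cases "\<exists>u\<in>{Suc \<tau>..t2}. s u f = Own")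
      case True
      then obtain u where u: "Suc \<tau> \<le> u" "u \<le> t2" "s u f = Own" by auto
      obtain w1 r1 where w1: "Suc \<tau> \<le> w1" "w1 < u" "r1 \<noteq> Own" "pile_at f r1 w1"
        using last_arrive[of "Suc \<tau>" u f Own] u tau(1) times by auto
      obtain w2 r2 where w2: "u \<le> w2" "w2 < t2" "r2 \<noteq> N2" "pile_at f r2 w2"
        using last_arrive[of u t2 f N2] u t2(1)[unfolded pSe] times by auto
      have "h f - 1 \<le> cnt (low f) (Suc \<tau>) w1"
        by (rule F[OF tau(3) w1(4)]) (use u w1 times in auto)
      moreover have "h f - 1 \<le> cnt (low f) w2 t2"
        by (rule F[OF w2(4) t2(1)[unfolded pSe, THEN conjunct2]]) (use w2 times in auto)
      moreover have "cnt (low f) (Suc \<tau>) w1 + cnt (low f) w2 t2 \<le> cnt (low f) \<tau> t2"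
        using split[of \<tau> "Suc \<tau>" t2 "low f"] split[of "Suc \<tau>" w1 t2 "low f"] split[of w1 w2 t2 "low f"]
          w1 w2 u cnt_nonneg[of "low f" w1 w2] cnt_nonneg[of "low f" \<tau> "Suc \<tau>"] by simp
      ultimately show ?thesis
        using F2 sub(2)[of \<tau> t2] split[of \<tau> t2 t4 "low (Suc e)"] times hs by (intro viaR) simp
    next
      case False
      then have nO: "s u f \<noteq> Own" if "Suc \<tau> \<le> u" "u \<le> t2" for u using that by auto
      have "s t1 f = N2" using nO[of t1] t1(3)[of f] times by (cases "s t1 f") (auto simp: defs)
      moreover have "s t5 f \<noteq> N2" using below[of f] by (simp add: defs)
      ultimately obtain u where u: "t1 \<le> u" "u < t5" "s u f = N2" "s (Suc u) f \<noteq> N2"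
        using first_leave[of t1 t5 f N2] t5 v times by auto
      then have "s (Suc u) f = N1" using nO[of "Suc u"] t5 v times by (cases "s (Suc u) f") auto
      then have "s u d = Own" if "d < f" for d
        using direct_move[of u f] u that t5 v times by (simp add: insert_commute)
      then have pu: "pile_at e Own u" by (rule pile_at_lessThan) (auto simp: defs)
      \<comment> \<open>\<open>low e\<close> runs through \<open>N2\<close>, \<open>Own\<close>,
        \<open>N1\<close>, \<open>N2\<close>: three relocations instead of two.\<close>
      have "h e - 1 \<le> cnt (low e) t1 u" "h e - 1 \<le> cnt (low e) u t5" "h e - 1 \<le> cnt (low e) t5 t3"
        using P[OF t1(2) pu] P[OF pu t5(7)] P[OF t5(7) e23(2)] r u t5 v times by auto
      then show ?thesis
        using split[of t1 u t3 "low e"] split[of u t5 t3 "low e"] u t5 v times hs by (intro viaP) simp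
    qed
  next
    case False
    then have eOwn: "s v e = Own" if "t1 < v" "v \<le> t2" for v
      using e12[OF that] that by (cases "s v e") auto
    have et2: "s t2 e = Own" using eOwn times by simp
    obtain t7 r where t7: "t2 \<le> t7" "t7 < t3" "s t7 e \<noteq> N2" "s (Suc t7) e = N2"
      "\<forall>v\<in>{t2..t7}. s v e \<noteq> N2" "r \<noteq> N2" "r \<noteq> s t7 e" "pile_at e r t7"
      using first_arrive[of t2 t3 e N2] et2 e23 times by auto
    have ret: "h e - 1 \<le> cnt (low e) t7 t3"
      using P[OF t7(8) e23(2)] t7 by simp
    have g1: "s t1 g = N2" "pile_at g N2 t1" using t1(2) by (simp_all add: pe)
    have g2: "s t2 g \<noteq> N1" using t2(2)[of g] by (simp add: defs)
    have f2: "s t2 f = N2" "pile_at f N2 t2" using t2(1) by (simp_all add: pSe)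
    have g7: "s t7 g = r" "pile_at g r t7" using t7(8) by (simp_all add: pe)
    have detour: ?thesis if "t1 \<le> b" "b \<le> u" "u \<le> t7" "pile_at e N2 b" "s u g \<noteq> N2" "s u g \<noteq> r" for b u
    proof -
      have "3 * (h g - 1) \<le> cnt (low e) b t7"
        unfolding e_def g_def
        by (rule pile_cost_detour[of b u t7 "Suc a" N2 "s u g" r]) (use that t7 times in \<open>auto simp: defs\<close>)
      then show ?thesis
        using ret split[of t1 b t3 "low e"] split[of b t7 t3 "low e"] that t7 hs
          cnt_nonneg[of "low e" t1 b] by (intro viaP) simp
    qed
    \<comment> \<open>\<open>r\<close> tells how \<open>e\<close> arrives at \<open>N2\<close>: from
      \<open>Own\<close> if \<open>r\<close> is \<open>N1\<close>, and from \<open>N1\<close> if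
      \<open>r\<close> is \<open>Own\<close>.\<close>
    show ?thesis
    proof (cases r)
      case N2 then show ?thesis using t7 by simp
    next
      case N1
      show ?thesis
      proof (cases "\<exists>u\<in>{t1..t7}. s u g = Own")
        case True
        then obtain u where "t1 \<le> u" "u \<le> t7" "s u g = Own" by auto
        then show ?thesis using detour[of t1 u] t1(2) N1 by simp
      next
        case False
        then have nO: "s u g \<noteq> Own" if "t1 \<le> u" "u \<le> t7" for u using that by auto
        have gt2: "s t2 g = N2" using g2 nO[of t2] times t7 by (cases "s t2 g") auto
        obtain u where u: "t2 \<le> u" "u < t7" "s u g = N2" "s (Suc u) g \<noteq> N2" "\<forall>v\<in>{t2..u}. s v g = N2"
          using first_leave[of t2 t7 g N2] gt2 g7 N1 t7 times by auto
        have uT: "u < T" using u t7 times by simp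
        have "s (Suc u) g = N1" using nO[of "Suc u"] u times by (cases "s (Suc u) g") auto
        then have "s u d = Own" if "d < g" for d
          using direct_move[of u g] u that uT by (simp add: insert_commute)
        then have pu: "pile_at f Own u" by (rule pile_at_lessThan) (auto simp: defs)
        \<comment> \<open>Disc \<open>g\<close> rests on the same neutral peg until \<open>u\<close>
          and keeps \<open>f\<close> there, so \<open>f\<close> has still to join
          \<open>low f\<close> on \<open>Own\<close> later.\<close>
        have fu: "s u f = N2"
          by (rule stuck_below[of t2 u f N2 g]) (use u uT f2 in \<open>auto simp: defs\<close>)
        have "2 * h f - 1 \<le> cnt (low (Suc e)) u t4"
          unfolding e_def f_def
          by (rule pile_cost_gather) (use u t7 times fu pu t4 in \<open>auto simp: defs\<close>)
        moreover have "h f - 1 \<le> cnt (low f) t2 u"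
          by (rule F[OF f2(2) pu]) (use u t7 times in auto)
        ultimately show ?thesis
          using F1 sub(2)[of \<tau> t2] sub(2)[of t2 u] split[of \<tau> t2 t4 "low (Suc e)"]
            split[of t2 u t4 "low (Suc e)"] u t7 times hs by (intro viaR) simp
      qed
    next
      case Own
      have et7: "s t7 e = N1" using t7 Own by (cases "s t7 e") auto
      obtain t6 r6 where t6: "t2 \<le> t6" "t6 < t7" "s t6 e \<noteq> N1" "s (Suc t6) e = N1"
        "r6 \<noteq> N1" "r6 \<noteq> s t6 e" "pile_at e r6 t6"
        using last_arrive[of t2 t7 e N1] et2 et7 t7 times by auto
      have "s t6 e = Own" using t6 t7(5) by (cases "s t6 e") auto
      then have p6: "pile_at e N2 t6" using t6 by (cases r6) auto
      then have g6: "s t6 g = N2" "pile_at g N2 t6" by (simp_all add: pe)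
      have forth: "h e - 1 \<le> cnt (low e) t6 t7"
        using P[OF p6 t7(8)] Own t6 t7 by simp
      have detour_g: ?thesis if "t1 \<le> u" "u \<le> t6" "pile_at g q u" "q \<noteq> N2" for u q
      proof -
        have "h g - 1 \<le> cnt (low g) t1 u" "h g - 1 \<le> cnt (low g) u t6"
          using G[OF g1(2) that(3)] G[OF that(3) g6(2)] that t6 t7 by auto
        then show ?thesis
          using forth ret split[of t1 u t6 "low g"] sub(1)[of t1 t6]
            split[of t1 t6 t3 "low e"] split[of t6 t7 t3 "low e"] that t6 t7 times hs
          by (intro viaP) simp
      qed
      \<comment> \<open>The relocations of \<open>low e\<close> between \<open>t6\<close>,
        \<open>t7\<close> and \<open>t3\<close> give only the base value. The surplus must come from
        \<open>low g\<close> before \<open>t6\<close>, from additional relocations within the class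
        of \<open>g\<close> up to \<open>t7\<close>, or from the class of \<open>f\<close>.\<close>
      show ?thesis
      proof (cases "\<exists>u\<in>{t1..t6}. s u g \<noteq> N2")
        case True
        then obtain u where u: "t1 \<le> u" "u \<le> t6" "s u g \<noteq> N2" by auto
        then obtain w q where "t1 \<le> w" "w < u" "q \<noteq> N2" "pile_at g q w"
          using first_leave[of t1 u g N2] g1 t6 t7 times by auto
        then show ?thesis using detour_g[of w q] u by simp
      next
        case False
        then have g16: "s u g = N2" if "t1 \<le> u" "u \<le> t6" for u using that by auto
        show ?thesis
        proof (cases "\<exists>u\<in>{t6..t7}. s u g = N1")
          case True
          then obtain u where "t6 \<le> u" "u \<le> t7" "s u g = N1" by auto
          then show ?thesis using detour[of t6 u] p6 Own t6 times by simp
        next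
          case False
          then have nN1: "s u g \<noteq> N1" if "t6 \<le> u" "u \<le> t7" for u using that by auto
          obtain t' r' where t': "t6 \<le> t'" "t' < t7" "s t' g = N2" "s (Suc t') g \<noteq> N2"
            "\<forall>v\<in>{t6..t'}. s v g = N2" "r' \<noteq> N2" "r' \<noteq> s (Suc t') g" "pile_at g r' t'"
            using first_leave[of t6 t7 g N2] g6 g7 Own t6 t7 times by auto
          have t'T: "t' < T" using t' t7 times by simp
          have "s (Suc t') g = Own" using t' nN1[of "Suc t'"] by (cases "s (Suc t') g") auto
          then have p': "pile_at g N1 t'" using t' by (cases r') auto
          have g2': "s v g = N2" if "t2 \<le> v" "v \<le> t'" for v
            using g16[of v] t'(5) that times by (cases "v \<le> t6") auto
          have f': "s t' f = N2"
            by (rule stuck_below[of t2 t' f N2 g]) (use t' t6 t'T f2 g2' in \<open>auto simp: defs\<close>)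
          have a': "s t' a \<noteq> N2"
            by (rule neutral_clear[OF t'T t'(4)[folded t'(3)]]) (use t' in \<open>auto simp: defs\<close>)
          have a2: "s t2 a = N2" "pile_at a N2 t2" using f2 by (simp_all add: pf)
          have t24: "t2 \<le> t'" "t' \<le> t3" using t' t6 t7 by auto
          have f4: "s t4 f = Own" "pile_at f Own t4" using t4 by (simp_all add: pSe)
          obtain w rw where w: "t' \<le> w" "w < t4" "s w f = N2" "rw \<noteq> N2" "pile_at f rw w"
            using first_leave[of t' t4 f N2] f' f4 t24 times by auto
          \<comment> \<open>\<open>a\<close> has left \<open>N2\<close> between \<open>t2\<close>
            and \<open>t'\<close>. A visit to \<open>Own\<close> is paid for by the class of
            \<open>f\<close>; a direct move to \<open>N1\<close> forces \<open>low g\<close> onto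
            \<open>Own\<close>.\<close>
          show ?thesis
          proof (cases "\<exists>u\<in>{t2..t'}. s u a = Own")
            case True
            then obtain u where u: "t2 \<le> u" "u \<le> t'" "s u a = Own" by auto
            have "h f + h (Suc e) + h g / 2 - 8 \<le> cnt (low (Suc e)) \<tau> t4"
            proof (cases rw)
              case N2 then show ?thesis using w by simp
            next
              case N1
              \<comment> \<open>The smallest surplus of all branches, only \<open>h a\<close>. Since
                \<open>h g <= 2 * h a\<close>, it is what limits the claim to
                \<open>h g / 2\<close>.\<close>
              have "3 * (h a - 1) \<le> cnt (low f) t2 w"
                unfolding f_def
                by (rule pile_cost_detour[of t2 u w a N2 Own N1])
                  (use u w N1 f2 times in \<open>auto simp: defs\<close>)
              moreover have "h f - 1 \<le> cnt (low f) w t4"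
                by (rule F[OF w(5) f4(2)]) (use w N1 in auto)
              ultimately show ?thesis
                using F1 sub(2)[of \<tau> t2] sub(2)[of t2 w] sub(2)[of w t4] split[of \<tau> t2 t4 "low (Suc e)"]
                  split[of t2 w t4 "low (Suc e)"] w t24 times hs by simp
            next
              case Own
              have "2 * h f - 1 \<le> cnt (low (Suc e)) w t4"
                unfolding e_def f_def
                by (rule pile_cost_gather) (use w Own times t4 in \<open>auto simp: defs\<close>)
              moreover have "h f - 1 \<le> cnt (low f) t2 w"
                by (rule F[OF f2(2) w(5)]) (use w Own t24 in auto)
              ultimately show ?thesis
                using F1 sub(2)[of \<tau> t2] sub(2)[of t2 w] split[of \<tau> t2 t4 "low (Suc e)"]
                  split[of t2 w t4 "low (Suc e)"] w t24 times hs by simp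
            qed
            then show ?thesis by (rule viaR)
          next
            case False
            then have nO: "s u a \<noteq> Own" if "t2 \<le> u" "u \<le> t'" for u using that by auto
            obtain u where u: "t2 \<le> u" "u < t'" "s u a = N2" "s (Suc u) a \<noteq> N2"
              using first_leave[of t2 t' a N2] a2 a' t24 times by auto
            then have "s (Suc u) a = N1" using nO[of "Suc u"] by (cases "s (Suc u) a") auto
            then have "s u d = Own" if "d < a" for d
              using direct_move[of u a] u that t'T by (simp add: insert_commute)
            then have pu: "pile_at g Own u" by (rule pile_at_lessThan) (auto simp: defs)
            show ?thesis
            proof (cases "u \<le> t6")
              case True
              then show ?thesis using detour_g[OF _ _ pu] u times by simp
            next
              case False
              \<comment> \<open>\<open>low g\<close> runs through \<open>N2\<close>,
                \<open>Own\<close>, \<open>N1\<close>, \<open>Own\<close> between \<open>t6\<close>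
                and \<open>t7\<close>.\<close>
              have "h g - 1 \<le> cnt (low g) t6 u" "h g - 1 \<le> cnt (low g) u t'" "h g - 1 \<le> cnt (low g) t' t7"
                using G[OF g6(2) pu] G[OF pu p'] G[OF p' g7(2)] False Own u t' t7 by auto
              then have "3 * (h g - 1) \<le> cnt (low e) t6 t7"
                using split[of t6 u t7 "low g"] split[of u t' t7 "low g"] sub(1)[of t6 t7] False u t' by simp
              then show ?thesis
                using ret split[of t1 t6 t3 "low e"] split[of t6 t7 t3 "low e"] t6 t7 times hs
                  cnt_nonneg[of "low e" t1 t6] by (intro viaP) simp
            qed
          qed
        qed
      qed
    qed
  qed
qed

text \<open>
  The optimal pattern is that disc \<open>e\<close> moves directly between the neutral pegs before disc
  \<open>Suc e\<close> leaves \<open>N1\<close>.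
\<close>

lemma own_move_bound:
  assumes bb: "\<And>k. k \<le> e \<Longrightarrow> beta_bound k"
    and times: "t0 \<le> t2" "t2 < t3" "t3 \<le> t4" "t4 \<le> T"
    and t0: "\<And>d. d \<le> e \<Longrightarrow> s t0 d = N1"
    and t2: "s t2 (Suc e) = N1" "s (Suc t2) (Suc e) = Own"
    and t3: "pile_at (Suc (Suc e)) N2 t3" and t4: "pile_at (Suc e) Own t4"
  shows "beta e + 2 * h (Suc e) + h e - err e - 5 \<le> cnt (low e) t0 t3 + cnt (low (Suc e)) t0 t4"
proof (cases "e < 3")
  case True
  then consider "e = 0" | "e = 1" | "e = 2" by linarith
  then have "beta e + 2 * h (Suc e) + h e - err e - 5 \<le> 0"
    by cases (simp_all add: bound_defs)
  then show ?thesis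
    using cnt_nonneg[of "low e" t0 t3] cnt_nonneg[of "low (Suc e)" t0 t4] by linarith
next
  case False
  then obtain a where e: "e = Suc (Suc (Suc a))"
    by (metis add.commute le_Suc_ex not_less numeral_3_eq_3 plus_nat.simps add_Suc_right add_0_right)
  define f where "f = Suc (Suc a)"
  have ef: "e = Suc f" by (simp add: e f_def)
  have cSe: "cnt (low (Suc e)) t t' = cnt {f} t t' + cnt (low f) t t'" for t t'
    by (simp add: ef cnt_low_Suc_Suc)
  have t2T: "t2 < T" "t2 \<le> T" using times by auto
  have p2: "pile_at (Suc e) N2 t2" and n2: "\<And>d. d \<le> e \<Longrightarrow> s t2 d \<noteq> N1"
    using leave_N1[OF t2T(1) t2(1)] t2(2) by (metis site.distinct(1,5) less_Suc_eq_le)+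
  have p3: "pile_at e N2 t3" using t3 by (simp add: pile_at_Suc_Suc)
  note split = cnt_split
  have R4: "h (Suc e) - 1 \<le> cnt (low (Suc e)) t2 t4"
    by (rule pile_cost[OF _ _ p2 t4]) (use times in auto)
  show ?thesis
  proof (cases "\<exists>u\<in>{t0..<t2}. {s u e, s (Suc u) e} = {N1, N2}")
    case True
    then obtain u where u: "t0 \<le> u" "u < t2" "{s u e, s (Suc u) e} = {N1, N2}" by auto
    have uT: "u < T" using u times by simp
    have Own: "s u d = Own" if "d < e" for d by (rule direct_move[OF uT u(3) that])
    have pu: "pile_at e Own u" "pile_at (Suc e) Own u"
      by (rule pile_at_lessThan[of e]; use Own in simp)+
    have "beta e - err e \<le> cnt {..<e} t0 u"
      by (rule beta_boundD) (use bb t0 Own u uT in auto)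
    moreover have "h (Suc e) - 1 \<le> cnt (low (Suc e)) u t2"
      by (rule pile_cost[OF _ _ pu(2) p2]) (use u times in auto)
    moreover have "h e - 1 \<le> cnt (low e) u t3"
      by (rule pile_cost[OF _ _ pu(1) p3]) (use u times in auto)
    ultimately show ?thesis
      using R4 split[of t0 u t3 "low e"] split[of t0 u t4 "low (Suc e)"] split[of u t2 t4 "low (Suc e)"]
        u times unfolding cnt_lessThan by simp
  next
    case False
    \<comment> \<open>The last departure is taken, not the first, so that \<open>e\<close> stays off
      \<open>N1\<close> until \<open>t2\<close>, as \<open>direct_extra\<close> requires.\<close>
    obtain t1 where t1: "t0 \<le> t1" "t1 < t2" "s t1 e = N1" "\<forall>v\<in>{t1<..t2}. s v e \<noteq> N1"
      using last_leave[OF times(1) t2T(2) t0[of e] n2[of e]] by auto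
    have t1T: "t1 < T" "t1 \<le> T" and leave1: "s (Suc t1) e \<noteq> N1" using t1 t2T by auto
    have not_direct: "s (Suc t1) e \<noteq> N2" using False t1 by (metis atLeastLessThan_iff)
    have own1: "s (Suc t1) e = Own" using leave1 not_direct by (cases "s (Suc t1) e") auto
    have p1: "pile_at e N2 t1" and n1: "\<And>d. d < e \<Longrightarrow> s t1 d \<noteq> N1"
      using leave_N1[OF t1T(1) t1(3) leave1] not_direct by metis+
    obtain v r where v: "Suc t1 \<le> v" "v < t3" "r \<noteq> N2" "pile_at e r v"
      using last_arrive[of "Suc t1" t3 e N2] t1 t3 times own1 by (auto simp: pile_at_Suc_Suc)
    have P: "2 * (h e - 1) \<le> cnt (low e) t1 t3"
      using pile_cost[OF _ _ p1 v(4)] pile_cost[OF _ _ v(4) p3] v times split[of t1 v t3 "low e"] by simp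
    have f: "s t0 f = N1" "s t1 f \<noteq> N1" using t0[of f] n1[of f] by (simp_all add: ef)
    obtain u where u: "t0 \<le> u" "u < t1" "s u f = N1" "s (Suc u) f \<noteq> N1"
      using first_leave[OF t1(1) t1T(2) f] by auto
    have uT: "u < T" using u t1T by simp
    have splits: "cnt (low e) t0 t3 = cnt (low e) t0 u + cnt (low e) u t1 + cnt (low e) t1 t3"
      "cnt (low (Suc e)) t0 t4 = cnt (low (Suc e)) t0 u + cnt (low (Suc e)) u t2 + cnt (low (Suc e)) t2 t4"
      "cnt (low (Suc e)) u t4 = cnt (low (Suc e)) u t2 + cnt (low (Suc e)) t2 t4"
      using split[of t0 u t3 "low e"] split[of u t1 t3 "low e"] split[of t0 u t4 "low (Suc e)"]
        split[of u t2 t4 "low (Suc e)"] u t1 times by simp_all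
    have cf: "cnt {..<f} t0 u = cnt (low f) t0 u + cnt (low e) t0 u"
      unfolding ef by (rule cnt_lessThan)
    show ?thesis using uT u(3,4)
    proof (cases rule: leave_N1)
      case own
      have "omega f - err f \<le> cnt {..<f} t0 u + cnt (low (Suc f)) u t1"
        by (rule omega_bound) (use bb t0 own u t1 t1T p1 in \<open>auto simp: ef dest: low_Suc_less\<close>)
      moreover have "2 * h f - 1 \<le> cnt (low (Suc (Suc f))) u t2"
        by (rule pile_cost_gather) (use own u t1 t2T p2 in \<open>auto simp: ef\<close>)
      moreover have "beta (Suc f) + 2 * h (Suc (Suc f)) + h (Suc f) - err (Suc f) - 5
          \<le> omega f - err f + (2 * h f - 1) + 2 * (h (Suc f) - 1) + (h (Suc (Suc f)) - 1)"
        by (cases f rule: h_parity_cases) (simp_all add: bound_defs)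
      ultimately show ?thesis
        using P R4 cf splits cSe[of t0 u] cnt_nonneg[of "{f}" t0 u] unfolding ef by linarith
    next
      case direct
      have pu: "pile_at e Own u" "pile_at f Own u"
        by (rule pile_at_lessThan[of f]; use direct in \<open>simp add: ef\<close>)+
      have pSu: "pile_at f Own (Suc u)"
        using pu(2) move_unique[OF uT, of f] direct u unfolding pile_at_def
        by (metis self_notin_low)
      have "beta f - err f \<le> cnt {..<f} t0 u"
        by (rule beta_boundD) (use bb t0 direct u uT in \<open>auto simp: ef\<close>)
      moreover have "h e - 1 \<le> cnt (low e) u t1"
        by (rule pile_cost[OF _ _ pu(1) p1]) (use u t1T in auto)
      moreover have "2 * h e + h f + h (Suc e) + h (Suc a) / 2 - 10
          \<le> cnt (low e) t1 t3 + cnt (low (Suc e)) u t4"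
        unfolding e f_def
        by (rule direct_extra[of u t1 t2 t3 t4 a])
          (use u t1 times direct pSu own1 p1 n1 p2 n2 t3 t4 in \<open>auto simp: e f_def\<close>)
      \<comment> \<open>For odd \<open>e\<close> the right side without the last summand would fall
        short by \<open>2/7 * h (Suc a)\<close> in leading terms.\<close>
      moreover have "beta e + 2 * h (Suc e) + h e - err e - 5
          \<le> beta f - err f + (h e - 1) + (2 * h e + h f + h (Suc e) + h (Suc a) / 2 - 10)"
        unfolding e f_def by (cases a rule: h_parity_cases) (simp_all add: bound_defs)
      ultimately show ?thesis
        using cf splits cSe[of t0 u] cnt_nonneg[of "{f}" t0 u] by linarith
    qed
  qed
qed

text \<open>Strong induction on the number of discs; the auxiliary bounds assume
  \<open>beta_bound\<close> for smaller numbers only, so they are available here. The cases are the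
  ways in which the two largest discs first leave \<open>N1\<close>.\<close>

lemma beta_bound: "beta_bound m"
proof (induction m rule: less_induct)
  case (less m)
  show ?case
  proof (cases "m < 3")
    case True
    then consider "m = 0" | "m = 1" | "m = 2" by linarith
    then have "beta m - err m \<le> 0" by cases (simp_all add: bound_defs)
    then show ?thesis unfolding beta_bound_def using cnt_nonneg order_trans by blast
  next
    case False
    then obtain e where m: "m = Suc (Suc (Suc e))"
      by (metis add.commute le_Suc_ex not_less numeral_3_eq_3 plus_nat.simps add_Suc_right add_0_right)
    define p where "p = Suc (Suc e)"
    have mp: "m = Suc p" by (simp add: m p_def)
    note split = cnt_split and sets = cnt_lessThan cnt_low_Suc_Suc
    show ?thesis unfolding beta_bound_def
    proof (intro allI impI)
      fix t t' assume tt: "t \<le> t'" "t' \<le> T" and t: "\<forall>d<m. s t d = N1" and t': "\<forall>d<m. s t' d = Own"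
      have pt': "pile_at j Own t'" if "j \<le> Suc m" for j
        by (rule pile_at_lessThan[of m]) (use t' that in auto)
      have "s t p = N1" "s t' p \<noteq> N1" using t t' by (simp_all add: mp)
      then obtain t3 where t3: "t \<le> t3" "t3 < t'" "s t3 p = N1" "s (Suc t3) p \<noteq> N1"
        using first_leave[OF tt] by blast
      have t3T: "t3 < T" "t3 \<le> T" using t3 tt by auto
      show "beta m - err m \<le> cnt {..<m} t t'" using t3T(1) t3(3,4)
      proof (cases rule: leave_N1)
        case direct
        have "beta p - err p \<le> cnt {..<p} t t3"
          by (rule beta_boundD) (use less.IH t direct t3 t3T in \<open>auto simp: mp\<close>)
        moreover have "2 * h p - 1 \<le> cnt (low (Suc (Suc p))) t3 t'"
          by (rule pile_cost_gather[where q = Own])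
            (use t3 tt direct pt' pile_at_lessThan[of p t3 Own] in \<open>auto simp: mp\<close>)
        moreover have "beta m - err m \<le> beta p - err p + (2 * h p - 1)"
          unfolding mp by (cases p rule: h_parity_cases) (simp_all add: bound_defs)
        ultimately show ?thesis
          using split[of t t3 t' "{..<m}"] t3 cnt_nonneg[of "{p}" t t3] cnt_nonneg[of "low (Suc p)" t3 t']
          unfolding mp sets by simp
      next
        case own
        have "s t (Suc e) = N1" "s t3 (Suc e) \<noteq> N1" using t own by (simp_all add: m p_def)
        then obtain t2 where t2: "t \<le> t2" "t2 < t3" "s t2 (Suc e) = N1" "s (Suc t2) (Suc e) \<noteq> N1"
          using first_leave[OF t3(1) t3T(2)] by blast
        have t2T: "t2 < T" using t2 t3T by simp
        have P: "h p - 1 \<le> cnt (low p) t3 t'"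
          by (rule pile_cost[OF _ _ own(2) pt']) (use t3 tt mp in auto)
        show ?thesis using t2T t2(3,4)
        proof (cases rule: leave_N1)
          case direct
          have pu: "pile_at p Own t2" "pile_at (Suc e) Own t2"
            by (rule pile_at_lessThan[of "Suc e"]; use direct in \<open>simp add: p_def\<close>)+
          have "beta (Suc e) - err (Suc e) \<le> cnt {..<Suc e} t t2"
            by (rule beta_boundD) (use less.IH t direct t2 t2T in \<open>auto simp: m\<close>)
          moreover have "h p - 1 \<le> cnt (low p) t2 t3"
            by (rule pile_cost[OF _ _ pu(1) own(2)]) (use t2 t3T in auto)
          moreover have "2 * h (Suc e) - 1 \<le> cnt (low (Suc (Suc (Suc e)))) t2 t'"
            by (rule pile_cost_gather[where q = Own]) (use t2 t3 tt direct pu pt'[of m] in \<open>auto simp: m\<close>)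
          moreover have "beta m - err m \<le> beta (Suc e) - err (Suc e) + 2 * (h p - 1) + (2 * h (Suc e) - 1)"
            unfolding m p_def by (cases e rule: h_parity_cases) (simp_all add: bound_defs)
          ultimately show ?thesis
            using P split[of t t2 t' "low p"] split[of t2 t3 t' "low p"] split[of t t2 t' "low m"]
              t2 t3 cnt_nonneg[of "{Suc e}" t t2] cnt_nonneg[of "{p}" t t']
            unfolding m p_def sets by simp
        next
          case own': own
          have "beta e + 2 * h (Suc e) + h e - err e - 5 \<le> cnt (low e) t t3 + cnt (low (Suc e)) t t'"
            by (rule own_move_bound[of e t t2]) (use less.IH t t2 t3 tt own own' pt' in \<open>auto simp: m p_def\<close>)
          \<comment> \<open>The only tight branch: since \<open>h p = 2 * h e\<close>, the leading
            terms form exactly the recurrence of \<open>beta\<close>.\<close>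
          moreover have "beta m - err m \<le> beta e + 2 * h (Suc e) + h e - err e - 5 + (h p - 1)"
            unfolding m p_def by (cases e rule: h_parity_cases) (simp_all add: bound_defs)
          moreover have "cnt (low p) t t' = cnt (low p) t t3 + cnt (low p) t3 t'"
            by (rule split) (use t3 in auto)
          ultimately show ?thesis
            using P cnt_nonneg[of "{e}" t t3] cnt_nonneg[of "{Suc e}" t t'] cnt_nonneg[of "{p}" t t']
            unfolding m p_def sets by linarith
        qed
      qed
    qed
  qed
qed

section \<open>Lower bounds for the other targets\<close>

lemma pass_to_N2_cases:
  assumes "s 0 p = N1" "s T p = N2"
  obtains (direct) u where "u < T" "{s u p, s (Suc u) p} = {N1, N2}" "\<And>d. d < p \<Longrightarrow> s u d = Own"
    | (via_own) t t' where "t < t'" "t' < T" "pile_at p N2 t" "\<And>d. d < p \<Longrightarrow> s t d \<noteq> N1"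
        "pile_at p N1 t'" "\<And>d. d < p \<Longrightarrow> s t' d \<noteq> N2"
proof (cases "\<exists>u<T. {s u p, s (Suc u) p} = {N1, N2}")
  case True
  then show ?thesis using direct_move that(1) by blast
next
  case False
  \<comment> \<open>Without a direct move the first departure from \<open>N1\<close> leads to
    \<open>Own\<close> and the last arrival at \<open>N2\<close> comes from \<open>Own\<close>, so
    the pile is on \<open>N2\<close> at the former and on \<open>N1\<close> at the latter.\<close>
  obtain t where t: "t < T" "s t p = N1" "s (Suc t) p \<noteq> N1" "\<forall>v\<in>{0..t}. s v p = N1"
    using first_leave[of 0 T p N1] assms by auto
  obtain t' r where t': "t' < T" "s t' p \<noteq> N2" "s (Suc t') p = N2" "r \<noteq> N2" "r \<noteq> s t' p" "pile_at p r t'"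
    using last_arrive[of 0 T p N2] assms by auto
  have "s t' p = Own" using t' False by (cases "s t' p") auto
  then have r: "pile_at p N1 t'" and tt: "t < t'"
    using t' t(4) by (cases r, simp_all) (metis atLeastAtMost_iff linorder_not_le site.distinct(1) zero_le)
  have "s t' d \<noteq> N2" if "d < p" for d
    by (rule neutral_clear[OF t'(1) _ that]) (use t' in auto)
  moreover have "pile_at p N2 t" "\<And>d. d < p \<Longrightarrow> s t d \<noteq> N1"
    using leave_N1[OF t(1-3)] t False by metis+
  ultimately show ?thesis using that(2) r tt t' by metis
qed

lemma lower_own:
  assumes "\<And>d. d < m \<Longrightarrow> s 0 d = N1" "\<And>d. d < m \<Longrightarrow> s T d = Own"
  shows "beta m - err m \<le> cnt {..<m} 0 T"
  by (rule beta_boundD[OF beta_bound]) (use assms in auto)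

text \<open>After a direct crossing of \<open>p\<close> all smaller discs are on their own pegs and
  only \<open>low p\<close> must follow. Passing through \<open>Own\<close> costs about
  \<open>nu p + 2 * h p\<close>, which is more.\<close>

lemma lower_neutral_own:
  assumes "\<And>d. d \<le> p \<Longrightarrow> s 0 d = N1" "pile_at (Suc (Suc p)) N2 T" "pile_at (Suc p) Own T"
  shows "beta p + h p - err p - 5 \<le> cnt {..<Suc p} 0 T"
proof -
  have T: "s T p = N2" "pile_at p N2 T" using assms(2) by (auto simp: pile_at_Suc_Suc)
  have N1: "s 0 p = N1" using assms by simp
  note sets = cnt_lessThan cnt_low_Suc_Suc
  from N1 T(1) show ?thesis
  proof (cases rule: pass_to_N2_cases)
    case (direct u)
    have "beta p - err p \<le> cnt {..<p} 0 u"
      by (rule beta_boundD[OF beta_bound]) (use assms direct in auto)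
    moreover have "h p - 1 \<le> cnt (low p) u T"
      by (rule pile_cost[of _ _ _ Own N2]) (use T direct pile_at_lessThan[of p u Own] in auto)
    ultimately show ?thesis
      using cnt_split[of 0 u T "{..<Suc p}"] direct(1) cnt_nonneg[of "{p}" 0 u] cnt_nonneg[of "{p}" u T]
        cnt_nonneg[of "low (Suc p)" u T]
      unfolding sets by simp
  next
    case (via_own t t')
    have "nu p - err p \<le> cnt {..<p} 0 t"
      by (rule nu_bound) (use assms via_own beta_bound in \<open>auto dest: low_Suc_less\<close>)
    moreover have "h p - 1 \<le> cnt (low p) t t'" "h p - 1 \<le> cnt (low p) t' T"
      using pile_cost[OF _ _ via_own(3,5)] pile_cost[OF _ _ via_own(5) T(2)] via_own by simp_all
    moreover have "beta p + h p - err p - 5 \<le> nu p - err p + 2 * (h p - 1)"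
      by (cases p rule: h_parity_cases) (simp_all add: bound_defs)
    ultimately show ?thesis
      using cnt_split[of 0 t T "{..<Suc p}"] cnt_split[of t t' T "low p"] via_own(1,2)
        cnt_nonneg[of "{p}" 0 t] cnt_nonneg[of "{p}" t T] cnt_nonneg[of "low (Suc p)" t T]
      unfolding sets by simp
  qed
qed

text \<open>This is \<open>own_move_bound\<close> with both final times equal to \<open>T\<close>.
  If \<open>p\<close> first crosses to \<open>N2\<close>, it has to join \<open>low p\<close> on the
  own peg afterwards, which is dearer.\<close>

lemma lower_own_neutral:
  assumes "\<And>d. d \<le> p \<Longrightarrow> s 0 d = N1" "pile_at (Suc (Suc p)) Own T" "pile_at (Suc p) N2 T"
  shows "kappa p - err p - 5 \<le> cnt {..<Suc p} 0 T"
proof (cases p)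
  case 0
  then have "kappa p - err p - 5 \<le> 0" by (simp add: kappa_def err_def)
  then show ?thesis using cnt_nonneg order_trans by blast
next
  case (Suc e)
  have T: "s T p = Own" "pile_at p Own T" using assms(2) by (auto simp: pile_at_Suc_Suc)
  obtain t where t: "t < T" "s t p = N1" "s (Suc t) p \<noteq> N1"
    using first_leave[of 0 T p N1] assms T by auto
  note sets = cnt_lessThan cnt_low_Suc_Suc
  show ?thesis using t
  proof (cases rule: leave_N1)
    case direct
    have pu: "pile_at p Own t" "pile_at (Suc p) Own t"
      by (rule pile_at_lessThan[of p]; use direct in simp)+
    have "beta p - err p \<le> cnt {..<p} 0 t"
      by (rule beta_boundD[OF beta_bound]) (use assms direct t in auto)
    moreover have "2 * h p - 1 \<le> cnt (low (Suc (Suc p))) t T"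
      by (rule pile_cost_gather[where q = Own]) (use assms pu t in auto)
    moreover have "h (Suc p) - 1 \<le> cnt (low (Suc p)) t T"
      by (rule pile_cost[OF _ _ pu(2) assms(3)]) (use t in auto)
    moreover have "kappa p - err p - 5 \<le> beta p - err p + (2 * h p - 1) + (h (Suc p) - 1)"
      by (cases p rule: h_parity_cases) (simp_all add: bound_defs kappa_def)
    ultimately show ?thesis
      using cnt_split[of 0 t T "{..<Suc p}"] t cnt_nonneg[of "{p}" 0 t]
      unfolding sets by simp
  next
    case own
    have "beta e + 2 * h (Suc e) + h e - err e - 5 \<le> cnt (low e) 0 T + cnt (low (Suc e)) 0 T"
      by (rule own_move_bound[of e 0 t]) (use assms T own t beta_bound in \<open>auto simp: Suc\<close>)
    moreover have "err e \<le> err p" by (simp add: Suc err_def)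
    ultimately show ?thesis
      using cnt_nonneg[of "{e}" 0 T] cnt_nonneg[of "{p}" 0 T] unfolding Suc kappa_Suc sets by linarith
  qed
qed

text \<open>A step moves a single disc, so the counted pairs of disc and time are determined by the
  time.\<close>

lemma cnt_le:
  assumes "finite D" "t \<le> t'" "t' \<le> T"
  shows "cnt D t t' \<le> real (t' - t)"
proof -
  have "cnt D t t' = real (card (SIGMA d:D. {u \<in> {t..<t'}. s (Suc u) d \<noteq> s u d}))"
    using assms(1) by (simp add: cnt_def card_SigmaI)
  also have "\<dots> \<le> real (card {t..<t'})"
  proof (intro of_nat_mono card_inj_on_le[of snd] inj_onI)
    fix x y assume "x \<in> (SIGMA d:D. {u \<in> {t..<t'}. s (Suc u) d \<noteq> s u d})"
      "y \<in> (SIGMA d:D. {u \<in> {t..<t'}. s (Suc u) d \<noteq> s u d})" "snd x = snd y"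
    then show "x = y" using move_unique[of "snd x" "fst x" "fst y"] assms(3)
      by (cases x; cases y) auto
  qed auto
  finally show ?thesis by simp
qed

end

section \<open>Mirror symmetry and time reversal\<close>

fun swap :: "site \<Rightarrow> site" where
  "swap N1 = N2" | "swap Own = Own" | "swap N2 = N1"

lemma swap_eq_iff [simp]: "swap x = swap y \<longleftrightarrow> x = y"
  "swap x = Own \<longleftrightarrow> x = Own" "swap x = N1 \<longleftrightarrow> x = N2" "swap x = N2 \<longleftrightarrow> x = N1"
  by (cases x; cases y; simp)+

lemma steps_sym: "(s, s') \<in> steps n \<Longrightarrow> (s', s) \<in> steps n"
proof -
  assume "(s, s') \<in> steps n"
  then obtain d q where dq: "s' = s(d := q)" "d < n" "q \<noteq> s d"
    "\<forall>d'<d. s d' \<in> {s d, q} \<longrightarrow> s d' = Own \<and> odd (d + d')"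
    by (auto simp: steps_def)
  then show "(s', s) \<in> steps n"
    unfolding steps_def by (intro CollectI exI[of _ s'] exI[of _ d] exI[of _ "s d"]) auto
qed

lemma steps_swap: "(s, s') \<in> steps n \<Longrightarrow> (\<lambda>d. swap (s d), \<lambda>d. swap (s' d)) \<in> steps n"
  unfolding steps_def by (force simp: fun_eq_iff)

context hanoi_path
begin

text \<open>The mirror image turns a reversed path from \<open>N1\<close> to \<open>N2\<close> into
  one from \<open>N1\<close> to \<open>N2\<close> again, so bounds for initial segments apply to
  final segments.\<close>

definition rev_path :: "nat \<Rightarrow> nat \<Rightarrow> site" where
  "rev_path u d = swap (s (T - u) d)"

lemma rev_path: "hanoi_path n T rev_path"
proof
  fix t assume "t < T"
  then have "(s (T - Suc t), s (T - t)) \<in> steps n"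
    using step[of "T - Suc t"] by (simp add: Suc_diff_Suc)
  from steps_swap[OF steps_sym[OF this]] show "(rev_path t, rev_path (Suc t)) \<in> steps n"
    by (simp add: rev_path_def[abs_def])
qed

lemma cnt_rev_path:
  assumes "t \<le> T"
  shows "hanoi_path.cnt rev_path D 0 (T - t) = cnt D t T"
proof -
  interpret R: hanoi_path n T rev_path by (rule rev_path)
  have "bij_betw (\<lambda>u. T - Suc u) {u \<in> {0..<T - t}. rev_path (Suc u) d \<noteq> rev_path u d}
      {u \<in> {t..<T}. s (Suc u) d \<noteq> s u d}" for d
    by (rule bij_betw_byWitness[where f' = "\<lambda>u. T - Suc u"])
      (use assms in \<open>auto simp: rev_path_def Suc_diff_Suc\<close>)
  from bij_betw_same_card[OF this] show ?thesis unfolding R.cnt_def cnt_def by (simp only:)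
qed

text \<open>A direct move of \<open>p\<close> cuts the path into two halves, each of which, the
  second after reversal, brings the smaller discs from \<open>N1\<close> to their own pegs.\<close>

lemma lower_neutral:
  assumes "\<And>d. d \<le> p \<Longrightarrow> s 0 d = N1" "\<And>d. d \<le> p \<Longrightarrow> s T d = N2"
  shows "2 * beta p - 2 * err p - 5 \<le> cnt {..<Suc p} 0 T"
proof -
  interpret R: hanoi_path n T rev_path by (rule rev_path)
  note sets = cnt_lessThan cnt_low_Suc_Suc
  have "s 0 p = N1" "s T p = N2" using assms by simp_all
  then show ?thesis
  proof (cases rule: pass_to_N2_cases)
    case (direct u)
    have "beta p - err p \<le> cnt {..<p} 0 u"
      by (rule beta_boundD[OF beta_bound]) (use assms direct in auto)
    moreover have "beta p - err p \<le> R.cnt {..<p} 0 (T - u)"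
      by (rule R.beta_boundD[OF R.beta_bound]) (use assms direct in \<open>auto simp: rev_path_def\<close>)
    ultimately show ?thesis
      using cnt_split[of 0 u T "{..<Suc p}"] direct(1) cnt_nonneg[of "{p}" 0 u] cnt_nonneg[of "{p}" u T]
        cnt_rev_path[of u "{..<p}"]
      unfolding sets by simp
  next
    case (via_own t t')
    have "nu p - err p \<le> cnt {..<p} 0 t"
      by (rule nu_bound) (use assms via_own beta_bound in \<open>auto dest: low_Suc_less\<close>)
    moreover have "h p - 1 \<le> cnt (low p) t t'"
      using pile_cost[OF _ _ via_own(3,5)] via_own by simp
    moreover have "nu p - err p \<le> R.cnt {..<p} 0 (T - t')"
      by (rule R.nu_bound)
        (use assms via_own R.beta_bound in \<open>auto simp: rev_path_def R.pile_at_def pile_at_def dest: low_Suc_less\<close>)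
    \<comment> \<open>For odd \<open>p\<close> the leading terms agree, so \<open>nu\<close> is just
      large enough here.\<close>
    moreover have "2 * beta p - 2 * err p - 5 \<le> 2 * (nu p - err p) + (h p - 1)"
      by (cases p rule: h_parity_cases) (simp_all add: bound_defs)
    ultimately show ?thesis
      using cnt_split[of 0 t T "{..<Suc p}"] cnt_split[of t t' T "{..<Suc p}"] via_own(1,2)
        cnt_nonneg[of "{p}" 0 t] cnt_nonneg[of "{p}" t t'] cnt_nonneg[of "{p}" t' T]
        cnt_nonneg[of "low (Suc p)" t t'] cnt_rev_path[of t' "{..<p}"]
      unfolding sets by simp
  qed
qed

end

section \<open>Upper bounds\<close>

definition reach :: "nat \<Rightarrow> real \<Rightarrow> (nat \<Rightarrow> site) \<Rightarrow> (nat \<Rightarrow> site) \<Rightarrow> bool" where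
  "reach n c s s' \<longleftrightarrow> (\<exists>k. real k \<le> c \<and> (s, s') \<in> steps n ^^ k)"

definition put :: "nat set \<Rightarrow> site \<Rightarrow> (nat \<Rightarrow> site) \<Rightarrow> nat \<Rightarrow> site" where
  "put D q s d = (if d \<in> D then q else s d)"

lemma put_low_parity:
  assumes "d < Suc p"
  shows "put (low (Suc (Suc p))) a (put (low (Suc p)) b s) d = (if even p = even d then a else b)"
  using assms by (auto simp: put_def low_def less_Suc_eq)

lemma reach_refl: "0 \<le> c \<Longrightarrow> reach n c s s"
  unfolding reach_def by (intro exI[of _ 0]) auto

lemma reach_trans: "reach n c s s' \<Longrightarrow> reach n c' s' s'' \<Longrightarrow> reach n (c + c') s s''"
  unfolding reach_def by (metis add_mono of_nat_add relpow_trans)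

lemma reach_mono: "reach n c s s' \<Longrightarrow> c \<le> c' \<Longrightarrow> reach n c' s s'"
  unfolding reach_def using order_trans by blast

lemma reach_sym: "reach n c s s' \<Longrightarrow> reach n c s' s"
proof -
  have "(steps n)\<inverse> = steps n" using steps_sym by auto
  moreover have "(R ^^ k)\<inverse> = (R\<inverse>) ^^ k" for R :: "('a \<times> 'a) set" and k
    by (induction k) (simp_all add: converse_relcomp relpow_commute)
  ultimately show "reach n c s s' \<Longrightarrow> reach n c s' s"
    unfolding reach_def by (metis converse_iff)
qed

lemma reach_move:
  assumes "d < n" "q \<noteq> s d" "\<And>d'. d' < d \<Longrightarrow> s d' \<in> {s d, q} \<Longrightarrow> s d' = Own \<and> odd (d + d')"
  shows "reach n 1 s (put {d} q s)"
proof -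
  have "put {d} q s = s(d := q)" by (auto simp: put_def)
  then have "(s, put {d} q s) \<in> steps n" unfolding steps_def using assms by blast
  then show ?thesis unfolding reach_def by (intro exI[of _ 1]) simp
qed

text \<open>The classical strategy works because smaller discs of the other parity are out of the
  way on their own peg. Only discs below the largest one of the pile, \<open>d - 2\<close>, can
  interfere, which explains \<open>Suc d' < d\<close>.\<close>

lemma reach_pile:
  assumes "low d \<subseteq> {..<n}" "\<And>d'. d' \<in> low d \<Longrightarrow> s d' = p"
    and "\<And>d'. \<lbrakk>Suc d' < d; odd (d + d')\<rbrakk> \<Longrightarrow> s d' = Own"
  shows "reach n (h d - 1) s (put (low d) q s)"
  using assms
proof (induction d arbitrary: s p q rule: induct_nat_012)
  case (ge2 d)
  show ?case
  proof (cases "p = q")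
    case True
    then have "put (low (Suc (Suc d))) q s = s" using ge2.prems by (auto simp: put_def)
    moreover have "1 \<le> h (Suc (Suc d))" by (rule one_le_power) simp
    ultimately show ?thesis by (simp add: reach_refl)
  next
    case False
    obtain r where r: "r \<noteq> p" "r \<noteq> q" by (metis site.distinct)
    have d: "d < n" "s d = p" "low d \<subseteq> {..<n}" "\<And>d'. d' \<in> low d \<Longrightarrow> s d' = p"
      using ge2.prems by (auto simp: low_Suc_Suc)
    have o: "s d' = Own" if "d' < d" "odd (d + d')" for d'
      using ge2.prems(3)[of d'] that by simp
    define s1 where "s1 = put (low d) r s"
    define s2 where "s2 = put {d} q s1"
    have r1: "reach n (h d - 1) s s1"
      unfolding s1_def by (rule ge2.IH(1)) (use d o in auto)
    have r2: "reach n 1 s1 s2"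
      unfolding s2_def
    proof (rule reach_move)
      have s1d: "s1 d = p" using d by (simp add: s1_def put_def)
      then show "q \<noteq> s1 d" using False by simp
      fix d' assume "d' < d" "s1 d' \<in> {s1 d, q}"
      then show "s1 d' = Own \<and> odd (d + d')"
        using o[of d'] r s1d by (cases "even (d + d')") (simp_all add: s1_def put_def low_def)
    qed (fact d(1))
    have r3: "reach n (h d - 1) s2 (put (low d) q s2)"
      by (rule ge2.IH(1)) (use d o in \<open>auto simp: s1_def s2_def put_def low_def\<close>)
    have "put (low d) q s2 = put (low (Suc (Suc d))) q s"
      by (auto simp: s1_def s2_def put_def low_Suc_Suc)
    with reach_trans[OF reach_trans[OF r1 r2] r3] show ?thesis by simp
  qed
qed (auto simp: put_def[abs_def] reach_refl)

text \<open>Of the \<open>3 * h e\<close>, one part moves \<open>low e\<close> over to the other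
  neutral peg; the rest is \<open>h (Suc (Suc e))\<close>, the price of finally bringing
  \<open>e\<close> and \<open>low e\<close> home. A surplus of one move per step is kept for a
  simpler formula.\<close>

fun cost_own :: "nat \<Rightarrow> real" where
  "cost_own 0 = 0" | "cost_own (Suc 0) = 1" | "cost_own (Suc (Suc 0)) = 2"
| "cost_own (Suc (Suc (Suc e))) = cost_own e + 2 * h (Suc e) + 3 * h e"

lemma cost_own_le: "cost_own m \<le> beta m + err m"
proof (induction m rule: cost_own.induct)
  case (4 e)
  then show ?case by (cases e rule: h_parity_cases) (simp_all add: bound_defs)
qed (simp_all add: bound_defs)

text \<open>The optimal pattern. With all smaller discs parked, \<open>e\<close> crosses directly;
  \<open>low (Suc e)\<close> gathers on \<open>q\<close> to free the own peg of \<open>Suc e\<close>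
  and later follows it home, hence the two terms \<open>h (Suc e)\<close>; finally
  \<open>low e\<close> joins \<open>e\<close>.\<close>

lemma reach_own_neutral_aux:
  assumes own: "reach n c s (put {..<e} Own s)" and "Suc e < n"
    and s: "\<And>d. d \<le> Suc e \<Longrightarrow> s d = p" and pq: "{p, q} = {N1, N2}"
  shows "reach n (c + 2 * h (Suc e) + h e - 1) s
    (put (low (Suc (Suc (Suc e)))) Own (put (low (Suc (Suc e))) q s))"
proof -
  have ne: "p \<noteq> q" "p \<noteq> Own" "q \<noteq> Own"
    using pq by (auto simp: doubleton_eq_iff)
  define s1 where "s1 = put {..<e} Own s"
  define s2 where "s2 = put {e} q s1"
  define s3 where "s3 = put (low (Suc e)) q s2"
  define s4 where "s4 = put {Suc e} Own s3"
  define s5 where "s5 = put (low (Suc e)) Own s4"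
  define s6 where "s6 = put (low e) q s5"
  note defs = s1_def s2_def s3_def s4_def s5_def s6_def
  have sub: "low e \<subseteq> {..<n}" "low (Suc e) \<subseteq> {..<n}" using assms(2) by (auto simp: low_def)
  have r1: "reach n c s s1" using own by (simp add: s1_def)
  have r2: "reach n 1 s1 s2" unfolding s2_def
    by (rule reach_move) (use assms(2) s ne in \<open>auto simp: s1_def put_def\<close>)
  have r3: "reach n (h (Suc e) - 1) s2 s3" unfolding s3_def
    by (rule reach_pile[where p = Own]) (use sub in \<open>auto simp: s1_def s2_def put_def low_def\<close>)
  have r4: "reach n 1 s3 s4" unfolding s4_def
  proof (rule reach_move)
    have v: "s3 d = (if d = e \<or> d \<in> low (Suc e) then q else if d < e then Own else s d)" for d
      by (simp add: s1_def s2_def s3_def put_def)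
    then have top: "s3 (Suc e) = p" using s by (simp add: low_def)
    then show "Own \<noteq> s3 (Suc e)" using ne by simp
    fix d' assume "d' < Suc e" "s3 d' \<in> {s3 (Suc e), Own}"
    then show "s3 d' = Own \<and> odd (Suc e + d')"
      using ne unfolding top v[of d'] by (auto simp: low_def split: if_splits)
  qed (fact assms(2))
  have r5: "reach n (h (Suc e) - 1) s4 s5" unfolding s5_def
    by (rule reach_pile[where p = q])
      (use sub in \<open>auto simp: s1_def s2_def s3_def s4_def put_def low_def\<close>)
  have r6: "reach n (h e - 1) s5 s6" unfolding s6_def
    by (rule reach_pile[where p = Own])
      (use sub in \<open>auto simp: s1_def s2_def s3_def s4_def s5_def put_def low_def\<close>)
  note r = reach_trans[OF reach_trans[OF reach_trans[OF reach_trans[OF reach_trans[OF r1 r2] r3] r4] r5] r6]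
  have eq: "s6 = put (low (Suc (Suc (Suc e)))) Own (put (low (Suc (Suc e))) q s)"
  proof
    fix d
    have "d \<in> low e \<Longrightarrow> d \<notin> low (Suc e)" "e \<notin> low (Suc e)" "Suc e \<notin> low e" "d < e \<longleftrightarrow> d \<in> low e \<or> d \<in> low (Suc e)"
      using low_disjoint low_Un[of e] by (auto simp: low_def)
    then show "s6 d = put (low (Suc (Suc (Suc e)))) Own (put (low (Suc (Suc e))) q s) d"
      by (simp add: defs put_def low_Suc_Suc)
  qed
  show ?thesis unfolding eq[symmetric] by (rule reach_mono[OF r]) simp
qed

text \<open>Either neutral peg is allowed as the start because the run from \<open>N2\<close>,
  reversed, forms the second half of \<open>reach_neutral\<close>.\<close>

lemma reach_own:
  assumes "m \<le> n" "\<And>d. d < m \<Longrightarrow> s d = p" "p \<noteq> Own"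
  shows "reach n (cost_own m) s (put {..<m} Own s)"
  using assms
proof (induction m rule: cost_own.induct)
  case 1
  then show ?case by (auto simp: put_def[abs_def] reach_refl)
next
  case 2
  have "put {..<Suc 0} Own s = put {0} Own s" by (auto simp: put_def)
  then show ?case using 2 by (auto intro!: reach_move)
next
  case 3
  have "reach n 1 s (put {0} Own s)" using 3 by (auto intro!: reach_move)
  moreover have "reach n 1 (put {0} Own s) (put {Suc 0} Own (put {0} Own s))"
    by (rule reach_move) (use 3 in \<open>auto simp: put_def\<close>)
  moreover have "put {Suc 0} Own (put {0} Own s) = put {..<Suc (Suc 0)} Own s"
    by (auto simp: put_def)
  ultimately show ?case using reach_trans by fastforce
next
  case (4 e)
  define q where "q = swap p"
  have pq: "{p, q} = {N1, N2}" using 4(4) by (cases p) (auto simp: q_def)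
  then have ne: "p \<noteq> q" "q \<noteq> Own" using 4(4) by (auto simp: doubleton_eq_iff)
  define s1 where "s1 = put (low (Suc (Suc (Suc e)))) Own (put (low (Suc (Suc e))) q s)"
  define s2 where "s2 = put {Suc (Suc e)} Own s1"
  have r1: "reach n (cost_own e) s (put {..<e} Own s)" by (rule "4.IH") (use 4 in auto)
  from r1 have r2: "reach n (cost_own e + 2 * h (Suc e) + h e - 1) s s1"
    unfolding s1_def by (rule reach_own_neutral_aux) (use 4 pq in auto)
  have r3: "reach n 1 s1 s2" unfolding s2_def
  proof (rule reach_move)
    have v: "s1 d = (if d \<in> low (Suc (Suc (Suc e))) then Own else if d \<in> low (Suc (Suc e)) then q else s d)" for d
      by (simp add: s1_def put_def)
    then have top: "s1 (Suc (Suc e)) = p" using 4(3) by (simp add: low_def)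
    then show "Own \<noteq> s1 (Suc (Suc e))" using 4(4) by simp
    fix d' assume "d' < Suc (Suc e)" "s1 d' \<in> {s1 (Suc (Suc e)), Own}"
    then show "s1 d' = Own \<and> odd (Suc (Suc e) + d')"
      using ne 4(4) unfolding top v[of d'] by (auto simp: low_def less_Suc_eq split: if_splits)
  qed (use 4(2) in simp)
  have r4: "reach n (h (Suc (Suc e)) - 1) s2 (put (low (Suc (Suc e))) Own s2)"
    by (rule reach_pile[where p = q]) (use 4(2-4) ne in \<open>auto simp: s1_def s2_def put_def low_def\<close>)
  have "put (low (Suc (Suc e))) Own s2 = put {..<Suc (Suc (Suc e))} Own s"
    by (rule ext) (auto simp: s1_def s2_def put_def low_def less_Suc_eq)
  with reach_trans[OF reach_trans[OF r2 r3] r4] show ?case by (auto elim: reach_mono)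
qed

lemma reach_own_N2:
  "reach (Suc p) (cost_own p + 1) (\<lambda>_. N1) (put {p} N2 (put {..<p} Own (\<lambda>_. N1)))"
proof (rule reach_trans)
  show "reach (Suc p) (cost_own p) (\<lambda>_. N1) (put {..<p} Own (\<lambda>_. N1))"
    by (rule reach_own) auto
  show "reach (Suc p) 1 (put {..<p} Own (\<lambda>_. N1)) (put {p} N2 (put {..<p} Own (\<lambda>_. N1)))"
    by (rule reach_move) (auto simp: put_def)
qed

lemma reach_neutral_own:
  "reach (Suc p) (cost_own p + h p) (\<lambda>_. N1)
    (put (low (Suc (Suc p))) N2 (put (low (Suc p)) Own (\<lambda>_. N1)))"
proof -
  define s where "s = put {p} N2 (put {..<p} Own (\<lambda>_. N1))"
  have "reach (Suc p) (h p - 1) s (put (low p) N2 s)"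
    by (rule reach_pile[where p = Own]) (auto simp: s_def put_def low_def)
  moreover have "put (low p) N2 s = put (low (Suc (Suc p))) N2 (put (low (Suc p)) Own (\<lambda>_. N1))"
    by (rule ext) (auto simp: s_def put_def low_def less_Suc_eq)
  ultimately show ?thesis
    using reach_trans[OF reach_own_N2[of p, folded s_def]] by fastforce
qed

lemma reach_neutral:
  "reach (Suc p) (2 * cost_own p + 1) (\<lambda>_. N1) (put {..p} N2 (\<lambda>_. N1))"
proof -
  define s where "s = put {..p} N2 (\<lambda>_. N1)"
  have "reach (Suc p) (cost_own p) (put {..<p} Own s) s"
    by (rule reach_sym, rule reach_own[where p = N2]) (auto simp: s_def put_def)
  moreover have "put {..<p} Own s = put {p} N2 (put {..<p} Own (\<lambda>_. N1))"
    by (rule ext) (auto simp: s_def put_def)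
  ultimately show ?thesis
    using reach_trans[OF reach_own_N2[of p]] unfolding s_def by fastforce
qed

lemma reach_own_neutral:
  "reach (Suc p) (kappa p + err p) (\<lambda>_. N1)
    (put (low (Suc (Suc p))) Own (put (low (Suc p)) N2 (\<lambda>_. N1)))"
proof (cases p)
  case 0
  have "reach (Suc 0) 1 (\<lambda>_. N1) (put {0} Own (\<lambda>_. N1))" by (rule reach_move) auto
  moreover have "put {0} Own (\<lambda>_. N1) = put (low (Suc (Suc 0))) Own (put (low (Suc 0)) N2 (\<lambda>_. N1))"
    by (auto simp: low_Suc_Suc put_def)
  ultimately show ?thesis
    unfolding 0 by (auto intro: reach_mono simp: kappa_def err_def)
next
  case (Suc e)
  have "reach (Suc (Suc e)) (cost_own e + 2 * h (Suc e) + h e - 1) (\<lambda>_. N1)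
      (put (low (Suc (Suc (Suc e)))) Own (put (low (Suc (Suc e))) N2 (\<lambda>_. N1)))"
    by (rule reach_own_neutral_aux[where p = N1]) (auto intro: reach_own)
  moreover have "cost_own e + 2 * h (Suc e) + h e - 1 \<le> kappa p + err p"
    unfolding Suc kappa_Suc using cost_own_le[of e] by (simp add: err_def)
  ultimately show ?thesis unfolding Suc by (rule reach_mono)
qed

section \<open>Transfer to pegs and limits\<close>

fun site_of :: "peg \<Rightarrow> site" where
  "site_of Neutral1 = N1" | "site_of Neutral2 = N2" | "site_of EvenPeg = Own" | "site_of OddPeg = Own"

definition peg_of :: "nat \<Rightarrow> site \<Rightarrow> peg" where
  "peg_of d p = (case p of N1 \<Rightarrow> Neutral1 | N2 \<Rightarrow> Neutral2 | Own \<Rightarrow> if even d then EvenPeg else OddPeg)"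

definition encode :: "nat \<Rightarrow> (nat \<Rightarrow> site) \<Rightarrow> nat \<Rightarrow> peg" where
  "encode n s = (\<lambda>d\<in>{1..n}. peg_of d (s (d - 1)))"

definition decode :: "(nat \<Rightarrow> peg) \<Rightarrow> nat \<Rightarrow> site" where
  "decode t d = site_of (t (Suc d))"

lemma peg_of_eq_iff: "peg_of x a = peg_of y b \<longleftrightarrow> a = b \<and> (a = Own \<longrightarrow> even (x + y))"
  by (cases a; cases b) (auto simp: peg_of_def)

lemma site_of_peg_of [simp]: "site_of (peg_of d p) = p"
  by (cases p) (auto simp: peg_of_def)

lemma peg_of_allowed: "peg_of d p \<in> allowed d"
  by (cases p) (auto simp: peg_of_def allowed_def)

lemma peg_of_site_of: "p \<in> allowed d \<Longrightarrow> peg_of d (site_of p) = p"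
  by (cases p) (auto simp: peg_of_def allowed_def split: if_splits)

lemma decode_encode: "d < n \<Longrightarrow> decode (encode n s) d = s d"
  by (simp add: decode_def encode_def)

lemma encode_cong: "(\<And>d. d < n \<Longrightarrow> s d = s' d) \<Longrightarrow> encode n s = encode n s'"
  unfolding encode_def by (rule restrict_ext) auto

lemma decode_legal_move:
  assumes "(t, t') \<in> legal_move n"
  shows "(decode t, decode t') \<in> steps n"
proof -
  obtain p q D where st: "t \<in> states n" and ne: "discs_on n t p \<noteq> {}" and D: "D = Min (discs_on n t p)"
    and q: "q \<noteq> p" "discs_on n t q = {} \<or> D < Min (discs_on n t q)"
    and al: "p \<in> allowed D" "q \<in> allowed D" and t': "t' = t(D := q)"
    using assms unfolding legal_move_def by blast
  have fin: "finite (discs_on n t r)" for r by (simp add: discs_on_def)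
  have "D \<in> discs_on n t p" unfolding D using Min_in[OF fin ne] .
  then obtain d where d: "D = Suc d" "d < n" "t (Suc d) = p"
    by (cases D) (auto simp: discs_on_def)
  have site_q: "site_of q \<noteq> decode t d"
    using q(1) d al peg_of_site_of unfolding decode_def by metis
  have "decode t d' = Own \<and> odd (d + d')" if "d' < d" "decode t d' \<in> {decode t d, site_of q}" for d'
  proof -
    have mem: "Suc d' \<in> discs_on n t r" if "t (Suc d') = r" for r
      using that \<open>d' < d\<close> d by (simp add: discs_on_def)
    have "t (Suc d') \<noteq> p"
      using Min_le[OF fin mem, of p] that(1) D d(1) by auto
    moreover have "t (Suc d') \<noteq> q"
      using Min_le[OF fin mem, of q] mem[of q] that(1) q(2) d(1) by auto
    moreover have "t (Suc d') \<in> allowed (Suc d')"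
      using st that(1) d(2) by (auto simp: states_def PiE_iff)
    then have "t (Suc d') = peg_of (Suc d') (decode t d')"
      by (simp add: peg_of_site_of decode_def)
    moreover have "p = peg_of (Suc d) (decode t d)" "q = peg_of (Suc d) (site_of q)"
      using al d by (simp_all add: peg_of_site_of decode_def)
    ultimately have "peg_of (Suc d') (decode t d') \<noteq> peg_of (Suc d) (decode t d')"
      using that(2) by (metis insertE singletonD)
    then show ?thesis unfolding peg_of_eq_iff by (simp add: add.commute)
  qed
  moreover have "decode t' = (decode t)(d := site_of q)"
    by (auto simp: decode_def t' d)
  ultimately show ?thesis
    unfolding steps_def using d(2) site_q by blast
qed

lemma encode_steps:
  assumes "(s, s') \<in> steps n"
  shows "(encode n s, encode n s') \<in> legal_move n"
proof -
  obtain d q where d: "s' = s(d := q)" "d < n" "q \<noteq> s d"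
    "\<forall>d'<d. s d' \<in> {s d, q} \<longrightarrow> s d' = Own \<and> odd (d + d')"
    using assms by (auto simp: steps_def)
  define D where "D = Suc d"
  have D: "encode n s D = peg_of D (s d)" "D \<in> {1..n}" using d by (auto simp: D_def encode_def)
  have below: "D \<le> x" if x: "x \<in> discs_on n (encode n s) (peg_of D r)" and "r \<in> {s d, q}" for x r
  proof (rule ccontr)
    assume "\<not> D \<le> x"
    then obtain d' where "x = Suc d'" "d' < d" using x by (cases x) (auto simp: D_def discs_on_def)
    then show False
      using x d(2) d(4)[rule_format, of d'] that(2) by (auto simp: D_def discs_on_def encode_def peg_of_eq_iff)
  qed
  have fin: "finite (discs_on n (encode n s) r)" for r by (simp add: discs_on_def)
  have mem: "D \<in> discs_on n (encode n s) (peg_of D (s d))" using D by (simp add: discs_on_def)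
  have Min: "D = Min (discs_on n (encode n s) (peg_of D (s d)))"
    by (rule Min_eqI[symmetric]) (use fin mem below in auto)
  have "discs_on n (encode n s) (peg_of D q) = {} \<or> D < Min (discs_on n (encode n s) (peg_of D q))"
  proof (cases "discs_on n (encode n s) (peg_of D q) = {}")
    case False
    have "D \<notin> discs_on n (encode n s) (peg_of D q)"
      using D d(3) by (auto simp: discs_on_def peg_of_eq_iff)
    then show ?thesis using below[of _ q] Min_in[OF fin False] by (metis insertCI le_neq_implies_less)
  qed simp
  moreover have "encode n s' = (encode n s)(D := peg_of D q)"
    using D(2) d(1) by (auto simp: encode_def D_def fun_eq_iff)
  moreover have "encode n s \<in> states n"
    by (auto simp: states_def encode_def peg_of_allowed)
  moreover have "peg_of D q \<noteq> peg_of D (s d)" using d(3) by (simp add: peg_of_eq_iff)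
  ultimately show ?thesis
    unfolding legal_move_def using mem Min peg_of_allowed by blast
qed

text \<open>The explicit strategy shows that the minimum is attained, so \<open>LEAST\<close> is
  meaningful; an optimal path of pegs is then decoded into a \<open>hanoi_path\<close>, to which the
  lower bounds apply.\<close>

lemma path_of_reach:
  assumes "reach n c s s'"
  obtains N \<sigma> where "hanoi_path n N \<sigma>" "N = min_moves n (encode n s) (encode n s')" "real N \<le> c"
    "\<And>d. d < n \<Longrightarrow> \<sigma> 0 d = s d" "\<And>d. d < n \<Longrightarrow> \<sigma> N d = s' d"
proof -
  obtain k where k: "real k \<le> c" "(s, s') \<in> steps n ^^ k" using assms by (auto simp: reach_def)
  have "(encode n x, encode n y) \<in> legal_move n ^^ j" if "(x, y) \<in> steps n ^^ j" for x y j
    using that by (induction j arbitrary: y) (auto intro: encode_steps)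
  note conn = this[OF k(2)]
  define N where "N = min_moves n (encode n s) (encode n s')"
  have "(encode n s, encode n s') \<in> legal_move n ^^ N"
    unfolding N_def min_moves_def by (rule LeastI[of _ k]) (rule conn)
  then obtain f where f: "f 0 = encode n s" "f N = encode n s'" "\<And>i. i < N \<Longrightarrow> (f i, f (Suc i)) \<in> legal_move n"
    by (auto simp: relpow_fun_conv)
  have "N \<le> k" unfolding N_def min_moves_def by (rule Least_le) (rule conn)
  then have "real N \<le> c" using k(1) by simp
  moreover have "hanoi_path n N (\<lambda>t. decode (f t))"
    by standard (use f(3) decode_legal_move in auto)
  ultimately show ?thesis
    by (intro that[of N "\<lambda>t. decode (f t)"]) (simp_all add: N_def[symmetric] f(1,2) decode_encode)
qed

lemma hanoi_a_bounds: "\<bar>real (hanoi_a (Suc p)) - 2 * beta p\<bar> \<le> 2 * err p + 5"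
proof -
  obtain N \<sigma> where path: "hanoi_path (Suc p) N \<sigma>"
    and N: "N = min_moves (Suc p) (encode (Suc p) (\<lambda>_. N1)) (encode (Suc p) (put {..p} N2 (\<lambda>_. N1)))"
    and ub: "real N \<le> 2 * cost_own p + 1"
    and ends: "\<And>d. d < Suc p \<Longrightarrow> \<sigma> 0 d = N1" "\<And>d. d < Suc p \<Longrightarrow> \<sigma> N d = put {..p} N2 (\<lambda>_. N1) d"
    using path_of_reach[OF reach_neutral[of p]] by metis
  interpret hanoi_path "Suc p" N \<sigma> by (rule path)
  have "2 * beta p - 2 * err p - 5 \<le> cnt {..<Suc p} 0 N"
    by (rule lower_neutral) (use ends in \<open>auto simp: put_def\<close>)
  moreover have "cnt {..<Suc p} 0 N \<le> real N" using cnt_le[of "{..<Suc p}" 0 N] by simp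
  moreover have "hanoi_a (Suc p) = N"
    unfolding N hanoi_a_def split_state_def encode_def
    by (intro arg_cong2[where f = "min_moves (Suc p)"] restrict_ext) (auto simp: put_def peg_of_def)
  ultimately show ?thesis using ub cost_own_le[of p] by simp
qed

lemma hanoi_b_bounds: "\<bar>real (hanoi_b m) - beta m\<bar> \<le> err m"
proof -
  obtain N \<sigma> where path: "hanoi_path m N \<sigma>"
    and N: "N = min_moves m (encode m (\<lambda>_. N1)) (encode m (put {..<m} Own (\<lambda>_. N1)))"
    and ub: "real N \<le> cost_own m"
    and ends: "\<And>d. d < m \<Longrightarrow> \<sigma> 0 d = N1" "\<And>d. d < m \<Longrightarrow> \<sigma> N d = put {..<m} Own (\<lambda>_. N1) d"
    using path_of_reach[OF reach_own[of m m "\<lambda>_. N1" N1]] by (metis order_refl site.distinct(1))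
  interpret hanoi_path m N \<sigma> by (rule path)
  have "beta m - err m \<le> cnt {..<m} 0 N"
    by (rule lower_own) (use ends in \<open>auto simp: put_def\<close>)
  moreover have "cnt {..<m} 0 N \<le> real N" using cnt_le[of "{..<m}" 0 N] by simp
  moreover have "hanoi_b m = N"
    unfolding N hanoi_b_def split_state_def encode_def
    by (intro arg_cong2[where f = "min_moves m"] restrict_ext) (auto simp: put_def peg_of_def)
  ultimately show ?thesis using ub cost_own_le[of m] by simp
qed

lemma neutral_own_bounds:
  "\<bar>real (min_moves (Suc p) (encode (Suc p) (\<lambda>_. N1))
      (encode (Suc p) (put (low (Suc (Suc p))) N2 (put (low (Suc p)) Own (\<lambda>_. N1))))) - (beta p + h p)\<bar>
    \<le> err p + 5"
proof -
  obtain N \<sigma> where path: "hanoi_path (Suc p) N \<sigma>"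
    and N: "N = min_moves (Suc p) (encode (Suc p) (\<lambda>_. N1))
      (encode (Suc p) (put (low (Suc (Suc p))) N2 (put (low (Suc p)) Own (\<lambda>_. N1))))"
    and ub: "real N \<le> cost_own p + h p"
    and ends: "\<And>d. d < Suc p \<Longrightarrow> \<sigma> 0 d = N1"
      "\<And>d. d < Suc p \<Longrightarrow> \<sigma> N d = put (low (Suc (Suc p))) N2 (put (low (Suc p)) Own (\<lambda>_. N1)) d"
    using path_of_reach[OF reach_neutral_own[of p]] by metis
  interpret hanoi_path "Suc p" N \<sigma> by (rule path)
  have "beta p + h p - err p - 5 \<le> cnt {..<Suc p} 0 N"
  proof (rule lower_neutral_own)
    show "\<sigma> 0 d = N1" if "d \<le> p" for d using ends(1)[of d] that by simp
  qed (use ends(2) put_low_parity[of _ p] in \<open>auto simp: pile_at_def low_def less_Suc_eq\<close>)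
  moreover have "cnt {..<Suc p} 0 N \<le> real N" using cnt_le[of "{..<Suc p}" 0 N] by simp
  ultimately show ?thesis unfolding N[symmetric] using ub cost_own_le[of p] by simp
qed

lemma own_neutral_bounds:
  "\<bar>real (min_moves (Suc p) (encode (Suc p) (\<lambda>_. N1))
      (encode (Suc p) (put (low (Suc (Suc p))) Own (put (low (Suc p)) N2 (\<lambda>_. N1))))) - kappa p\<bar>
    \<le> err p + 5"
proof -
  obtain N \<sigma> where path: "hanoi_path (Suc p) N \<sigma>"
    and N: "N = min_moves (Suc p) (encode (Suc p) (\<lambda>_. N1))
      (encode (Suc p) (put (low (Suc (Suc p))) Own (put (low (Suc p)) N2 (\<lambda>_. N1))))"
    and ub: "real N \<le> kappa p + err p"
    and ends: "\<And>d. d < Suc p \<Longrightarrow> \<sigma> 0 d = N1"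
      "\<And>d. d < Suc p \<Longrightarrow> \<sigma> N d = put (low (Suc (Suc p))) Own (put (low (Suc p)) N2 (\<lambda>_. N1)) d"
    using path_of_reach[OF reach_own_neutral[of p]] by metis
  interpret hanoi_path "Suc p" N \<sigma> by (rule path)
  have "kappa p - err p - 5 \<le> cnt {..<Suc p} 0 N"
  proof (rule lower_own_neutral)
    show "\<sigma> 0 d = N1" if "d \<le> p" for d using ends(1)[of d] that by simp
  qed (use ends(2) put_low_parity[of _ p] in \<open>auto simp: pile_at_def low_def less_Suc_eq\<close>)
  moreover have "cnt {..<Suc p} 0 N \<le> real N" using cnt_le[of "{..<Suc p}" 0 N] by simp
  ultimately show ?thesis unfolding N[symmetric] using ub by simp
qed

lemma split_state_encode:
  "split_state n Neutral1 Neutral1 = encode n (\<lambda>_. N1)"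
  "split_state n Neutral2 OddPeg = encode n (\<lambda>d. if even d then Own else N2)"
  "split_state n EvenPeg Neutral2 = encode n (\<lambda>d. if even d then N2 else Own)"
  unfolding split_state_def encode_def by (rule restrict_ext; auto simp: peg_of_def)+

text \<open>The largest disc \<open>p\<close> carries the label \<open>p + 1\<close>, so for even
  \<open>p\<close> its class is the odd one and ends on its own peg.\<close>

lemma hanoi_c_bounds:
  "\<bar>real (hanoi_c (Suc p)) - (if even p then kappa p else beta p + h p)\<bar> \<le> err p + 5"
proof (cases "even p")
  case True
  then have "split_state (Suc p) Neutral2 OddPeg =
      encode (Suc p) (put (low (Suc (Suc p))) Own (put (low (Suc p)) N2 (\<lambda>_. N1)))"
    unfolding split_state_encode by (intro encode_cong) (simp add: put_low_parity)
  then show ?thesis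
    using own_neutral_bounds[of p] True by (simp add: hanoi_c_def split_state_encode(1))
next
  case False
  then have "split_state (Suc p) Neutral2 OddPeg =
      encode (Suc p) (put (low (Suc (Suc p))) N2 (put (low (Suc p)) Own (\<lambda>_. N1)))"
    unfolding split_state_encode by (intro encode_cong) (simp add: put_low_parity)
  then show ?thesis
    using neutral_own_bounds[of p] False by (simp add: hanoi_c_def split_state_encode(1))
qed

lemma hanoi_d_bounds:
  "\<bar>real (hanoi_d (Suc p)) - (if even p then beta p + h p else kappa p)\<bar> \<le> err p + 5"
proof (cases "even p")
  case True
  then have "split_state (Suc p) EvenPeg Neutral2 =
      encode (Suc p) (put (low (Suc (Suc p))) N2 (put (low (Suc p)) Own (\<lambda>_. N1)))"
    unfolding split_state_encode by (intro encode_cong) (simp add: put_low_parity)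
  then show ?thesis
    using neutral_own_bounds[of p] True by (simp add: hanoi_d_def split_state_encode(1))
next
  case False
  then have "split_state (Suc p) EvenPeg Neutral2 =
      encode (Suc p) (put (low (Suc (Suc p))) Own (put (low (Suc p)) N2 (\<lambda>_. N1)))"
    unfolding split_state_encode by (intro encode_cong) (simp add: put_low_parity)
  then show ?thesis
    using own_neutral_bounds[of p] False by (simp add: hanoi_d_def split_state_encode(1))
qed

section \<open>From linear errors to limits of ratios\<close>

lemma ratio_limits:
  fixes x :: "nat \<Rightarrow> nat" and P Q C :: real
  assumes odd: "\<And>k. \<bar>real (x (Suc (2 * k))) - P * 2 ^ k\<bar> \<le> C * (real k + 1)"
    and even: "\<And>k. \<bar>real (x (Suc (Suc (2 * k)))) - Q * 2 ^ k\<bar> \<le> C * (real k + 1)"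
    and "P \<noteq> 0" "Q \<noteq> 0"
  shows "(\<lambda>k. real (x (2 * k)) / real (x (2 * k - 1))) \<longlonglongrightarrow> Q / P"
    and "(\<lambda>k. real (x (2 * k + 1)) / real (x (2 * k))) \<longlonglongrightarrow> 2 * P / Q"
proof -
  have "(\<lambda>k. real k / 2 ^ k) \<longlonglongrightarrow> 0" by (rule lim_n_over_pown) simp
  moreover have "(\<lambda>k. (1/2::real) ^ k) \<longlonglongrightarrow> 0" by (rule LIMSEQ_realpow_zero) simp_all
  ultimately have "(\<lambda>k. C * (real k / 2 ^ k + (1/2) ^ k)) \<longlonglongrightarrow> C * (0 + 0)"
    by (intro tendsto_mult tendsto_add tendsto_const)
  then have err0: "(\<lambda>k. C * (real k + 1) / 2 ^ k) \<longlonglongrightarrow> 0"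
    by (simp add: power_one_over add_divide_distrib distrib_left inverse_eq_divide)
  have lim: "(\<lambda>k. y k / 2 ^ k) \<longlonglongrightarrow> A" if "\<And>k. \<bar>y k - A * 2 ^ k\<bar> \<le> C * (real k + 1)" for y A
  proof (rule LIM_zero_cancel, rule tendsto_rabs_zero_cancel, rule tendsto_sandwich[OF _ _ tendsto_const err0])
    show "\<forall>\<^sub>F k in sequentially. \<bar>y k / 2 ^ k - A\<bar> \<le> C * (real k + 1) / 2 ^ k"
    proof (intro always_eventually allI)
      fix k
      have "y k / 2 ^ k - A = (y k - A * 2 ^ k) / 2 ^ k" by (simp add: diff_divide_distrib)
      then show "\<bar>y k / 2 ^ k - A\<bar> \<le> C * (real k + 1) / 2 ^ k"
        using that[of k] by (simp add: abs_divide divide_right_mono)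
    qed
  qed simp
  have o: "(\<lambda>k. real (x (Suc (2 * k))) / 2 ^ k) \<longlonglongrightarrow> P" by (rule lim) (rule odd)
  have e: "(\<lambda>k. real (x (Suc (Suc (2 * k)))) / 2 ^ k) \<longlonglongrightarrow> Q" by (rule lim) (rule even)
  \<comment> \<open>The index \<open>2 * k + 3\<close> belongs to the power
    \<open>2 ^ Suc k\<close>, which yields the factor 2.\<close>
  have "(\<lambda>k. 2 * (real (x (Suc (2 * Suc k))) / 2 ^ Suc k)) \<longlonglongrightarrow> 2 * P"
    using o by (intro tendsto_intros) (rule LIMSEQ_Suc)
  then have o': "(\<lambda>k. real (x (Suc (Suc (Suc (2 * k))))) / 2 ^ k) \<longlonglongrightarrow> 2 * P" by simp
  \<comment> \<open>The shift by one avoids the truncated index \<open>2 * k - 1\<close> at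
    \<open>k = 0\<close>.\<close>
  have "(\<lambda>k. real (x (2 * Suc k)) / real (x (2 * Suc k - 1))) \<longlonglongrightarrow> Q / P"
    using tendsto_divide[OF e o assms(3)] by simp
  then show "(\<lambda>k. real (x (2 * k)) / real (x (2 * k - 1))) \<longlonglongrightarrow> Q / P"
    by (rule LIMSEQ_imp_Suc)
  have "(\<lambda>k. real (x (2 * Suc k + 1)) / real (x (2 * Suc k))) \<longlonglongrightarrow> 2 * P / Q"
    using tendsto_divide[OF o' e assms(4)] by simp
  then show "(\<lambda>k. real (x (2 * k + 1)) / real (x (2 * k))) \<longlonglongrightarrow> 2 * P / Q"
    by (rule LIMSEQ_imp_Suc)
qed

text \<open>The factor 100 is a common bound for all errors, the largest being
  \<open>2 * err p + 5\<close> for \<open>hanoi_a\<close>.\<close>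

lemma hanoi_odd_bounds:
  "\<bar>real (hanoi_a (Suc (2 * k))) - 38/7 * 2 ^ k\<bar> \<le> 100 * (real k + 1)"
  "\<bar>real (hanoi_b (Suc (2 * k))) - 27/7 * 2 ^ k\<bar> \<le> 100 * (real k + 1)"
  "\<bar>real (hanoi_c (Suc (2 * k))) - 31/7 * 2 ^ k\<bar> \<le> 100 * (real k + 1)"
  "\<bar>real (hanoi_d (Suc (2 * k))) - 26/7 * 2 ^ k\<bar> \<le> 100 * (real k + 1)"
  using hanoi_a_bounds[of "2 * k"] hanoi_b_bounds[of "Suc (2 * k)"]
    hanoi_c_bounds[of "2 * k"] hanoi_d_bounds[of "2 * k"]
  by (simp_all add: beta_def kappa_def err_def)

lemma hanoi_even_bounds:
  "\<bar>real (hanoi_a (Suc (Suc (2 * k)))) - 54/7 * 2 ^ k\<bar> \<le> 100 * (real k + 1)"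
  "\<bar>real (hanoi_b (Suc (Suc (2 * k)))) - 38/7 * 2 ^ k\<bar> \<le> 100 * (real k + 1)"
  "\<bar>real (hanoi_c (Suc (Suc (2 * k)))) - 34/7 * 2 ^ k\<bar> \<le> 100 * (real k + 1)"
  "\<bar>real (hanoi_d (Suc (Suc (2 * k)))) - 40/7 * 2 ^ k\<bar> \<le> 100 * (real k + 1)"
  using hanoi_a_bounds[of "Suc (2 * k)"] hanoi_b_bounds[of "Suc (Suc (2 * k))"]
    hanoi_c_bounds[of "Suc (2 * k)"] hanoi_d_bounds[of "Suc (2 * k)"]
  by (simp_all add: beta_def kappa_def err_def)

theorem theorem5p3:
  shows "((\<lambda>k. real (hanoi_a (2 * k)) / real (hanoi_a (2 * k - 1))) \<longlonglongrightarrow> 27 / 19) \<and>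
         ((\<lambda>k. real (hanoi_a (2 * k + 1)) / real (hanoi_a (2 * k))) \<longlonglongrightarrow> 38 / 27) \<and>
         ((\<lambda>k. real (hanoi_b (2 * k)) / real (hanoi_b (2 * k - 1))) \<longlonglongrightarrow> 38 / 27) \<and>
         ((\<lambda>k. real (hanoi_b (2 * k + 1)) / real (hanoi_b (2 * k))) \<longlonglongrightarrow> 27 / 19) \<and>
         ((\<lambda>k. real (hanoi_c (2 * k)) / real (hanoi_c (2 * k - 1))) \<longlonglongrightarrow> 34 / 31) \<and>
         ((\<lambda>k. real (hanoi_c (2 * k + 1)) / real (hanoi_c (2 * k))) \<longlonglongrightarrow> 62 / 34) \<and>
         ((\<lambda>k. real (hanoi_d (2 * k)) / real (hanoi_d (2 * k - 1))) \<longlonglongrightarrow> 20 / 13) \<and>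
         ((\<lambda>k. real (hanoi_d (2 * k + 1)) / real (hanoi_d (2 * k))) \<longlonglongrightarrow> 26 / 20)"
  using ratio_limits[OF hanoi_odd_bounds(1) hanoi_even_bounds(1)]
    ratio_limits[OF hanoi_odd_bounds(2) hanoi_even_bounds(2)]
    ratio_limits[OF hanoi_odd_bounds(3) hanoi_even_bounds(3)]
    ratio_limits[OF hanoi_odd_bounds(4) hanoi_even_bounds(4)]
  by simp

end
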